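(* Let $Q$ be the infinitesimal generator of an ergodic regular-jump Markov chain $\{(X(t),J(t));t\ge 0\}$ on $\mathbb F$ with stationary distribution $\pi$, and assume that for each $n\in\mathbb N$ the LC-block-augmented truncation ${}_{(n)}Q$ has a unique closed communicating class in $\mathbb F_n$; let ${}_{(n)}\pi$ be its stationary distribution. Suppose there exist $b>0$, $K\in\mathbb Z_+$ and column vectors $v\ge 0$, $f\ge e$ on $\mathbb F$ such that $Qv\le -f+b\,1_{\mathbb F_K}$ and $$\overline C_{f/v}:=\sup_{(k,i)\in\mathbb F}\frac{f(k,i)}{v(k,i)}<\infty .$$ Let $$\widehat\pi=\frac{\pi\Delta_{f/v}}{\pi(f/v)},\qquad {}_{(n)}\widehat\pi=\frac{{}_{(n)}\pi\,\Delta_{f/v}}{{}_{(n)}\pi(f/v)}\ (n\in\mathbb N),\qquad \widehat b=b\max_{(k,i)\in\mathbb F_K}\frac{v(k,i)}{f(k,i)} .$$ Suppose furthermore that there exists a function $\widehat E:[0,\infty)\to[0,\infty)$ such that $$\sup_{e\le\widehat g\le v}\frac{|\widehat\pi-{}_{(n)}\widehat\pi|\,\widehat g}{\widehat\pi\,\widehat g}\le\widehat E(n),\qquad n\in\mathbb N.$$ Then for all $n\in\mathbb N$, $$|\pi-{}_{(n)}\pi|\,e\le 2\widehat E(n),$$ $$\sup_{e\le g\le f}\frac{|\pi-{}_{(n)}\pi|\,g}{\pi g}\le\widehat E(n)\left[1+\frac{1+\widehat E(n)}{\max\{\,1-\min(\widehat E(n),1),\ (\widehat b\,\overline C_{f/v})^{-1}\}}\right].$$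 In addition, if the subvector $(v(k,i))_{(k,i)\in\overline{\mathbb F}_0}$ is level-wise nondecreasing, then for all $n\in\mathbb N$, $$\sup_{e\le g\le f}\frac{|\pi-{}_{(n)}\pi|\,g}{\pi g}\le\widehat E(n)\left[1+\min\left\{\frac{1+\widehat E(n)}{\max\{\,1-\min(\widehat E(n),1),\ (\widehat b\,\overline C_{f/v})^{-1}\}},\ b\right\}\right].$$
   Context: Notation: $\mathbb Z_+=\{0,1,2,\dots\}$, $\mathbb N=\{1,2,\dots\}$. For $k\in\mathbb Z_+$, $\mathbb S_k=\{0,1,\dots,S_k\}$ with $S_k\in\mathbb Z_+$, and $S_k=S_1$ for all $k\in\mathbb N$. Levels: $\mathbb L_k=\{k\}\times\mathbb S_k$; $\mathbb F=\bigcup_{k\ge0}\mathbb L_k$, $\mathbb F_n=\bigcup_{k=0}^n\mathbb L_k$, $\overline{\mathbb F}_n=\mathbb F\setminus\mathbb F_n$. For a vector $x=(x(k,i))_{(k,i)\in\mathbb F}$, $x(k)=(x(k,i))_{i\in\mathbb S_k}$ is its subvector for level $k$. The subvector of $v$ on $\overline{\mathbb F}_0$ is level-wise nondecreasing if $v(k)\le v(k+1)$ for all $k\in\mathbb N$. $e$ is a column vector of ones, $1_{\mathbb C}$ is the column indicator vector of $\mathbb C\subseteq\mathbb F$; inequalities and absolute values $|\cdot|$ of vectors and matrices are entrywise. $\Delta_x$ is the diagonal matrix whose diagonal is the vector $x$; $x/y$ (for $y>0$) is the entrywise quotient. (Since $f\ge e$, finiteness of $\overline C_{f/v}$ means in particular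 that $v>0$.) $\{(X(t),J(t))\}$ is a continuous-time regular-jump (non-explosive) Markov chain with state space $\mathbb F$ and stable, conservative infinitesimal generator $Q=(q(k,i;\ell,j))$ with blocks $Q(k;\ell)=(q(k,i;\ell,j))_{i\in\mathbb S_k,\,j\in\mathbb S_\ell}$. Ergodic means irreducible and positive recurrent; $\pi$ is the unique stationary distribution (row vector, $\pi Q=0$, $\pi e=1$). For $n\in\mathbb N$, the last-column-block-augmented (LC-block-augmented) truncation ${}_{(n)}Q$ of $Q$ is the conservative $q$-matrix on $\mathbb F$ with blocks $${}_{(n)}Q(k;\ell)=\begin{cases}Q(k;\ell),&k\in\mathbb Z_+,\ 0\le\ell\le n-1,\\ Q(k;n)+\sum_{m>n,\,m\ne k}Q(k;m),&k\in\mathbb Z_+,\ \ell=n,\\ Q(k;k),&k=\ell\ge n+1,\\ O,&\text{otherwise.}\end{cases}$$ ${}_{(n)}\pi=({}_{(n)}\pi(k,i))_{(k,i)\in\mathbb F}$ is its unique stationary distribution (row vector); ${}_{(n)}\pi(k)=0$ for $k\ge n+1$.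
   Formalization: The supremum in the hypothesis on Ê is taken over min(e, v/f) ≤ ĝ ≤ v (entrywise minimum) instead of e ≤ ĝ ≤ v; the two agree when f ≤ v, and with the original range the claim is false in general. *)

theory Defs
  imports "HOL-Probability.Probability"
begin

section \<open>State space\<close>

type_synonym state = "nat \<times> nat"

definition states :: "(nat \<Rightarrow> nat) \<Rightarrow> state set"
  where "states S = {(k, i). i \<le> S k}"

definition states_upto :: "(nat \<Rightarrow> nat) \<Rightarrow> nat \<Rightarrow> state set"
  where "states_upto S n = {(k, i). k \<le> n \<and> i \<le> S k}"

definition levelwise_nondecreasing :: "(nat \<Rightarrow> nat) \<Rightarrow> (state \<Rightarrow> real) \<Rightarrow> bool"
  where "levelwise_nondecreasing S v \<longleftrightarrow> (\<forall>k\<ge>1. \<forall>i\<le>S k. v (k, i) \<le> v (Suc k, i))"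


section \<open>Conservative q-matrices\<close>

text \<open>Stability is built in because the entries are reals; the diagonal entries are
  nonpositive because every row sums to zero.\<close>

definition conservative_q_matrix :: "'a set \<Rightarrow> ('a \<Rightarrow> 'a \<Rightarrow> real) \<Rightarrow> bool"
  where "conservative_q_matrix F q \<longleftrightarrow>
    (\<forall>x\<in>F. \<forall>y\<in>F. x \<noteq> y \<longrightarrow> 0 \<le> q x y) \<and> (\<forall>x\<in>F. (q x has_sum 0) F)"

definition leads_to :: "'a set \<Rightarrow> ('a \<Rightarrow> 'a \<Rightarrow> real) \<Rightarrow> 'a \<Rightarrow> 'a \<Rightarrow> bool"
  where "leads_to F q x y \<longleftrightarrow> (x, y) \<in> {(a, b). a \<in> F \<and> b \<in> F \<and> 0 < q a b}\<^sup>*"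

definition irreducible_q :: "'a set \<Rightarrow> ('a \<Rightarrow> 'a \<Rightarrow> real) \<Rightarrow> bool"
  where "irreducible_q F q \<longleftrightarrow> (\<forall>x\<in>F. \<forall>y\<in>F. leads_to F q x y)"

definition communicating_class :: "'a set \<Rightarrow> ('a \<Rightarrow> 'a \<Rightarrow> real) \<Rightarrow> 'a set \<Rightarrow> bool"
  where "communicating_class F q C \<longleftrightarrow>
    (\<exists>x\<in>F. C = {y \<in> F. leads_to F q x y \<and> leads_to F q y x})"

definition closed_class :: "'a set \<Rightarrow> ('a \<Rightarrow> 'a \<Rightarrow> real) \<Rightarrow> 'a set \<Rightarrow> bool"
  where "closed_class F q C \<longleftrightarrow> (\<forall>x\<in>C. \<forall>y\<in>F. 0 < q x y \<longrightarrow> y \<in> C)"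

definition stationary_distribution :: "'a set \<Rightarrow> ('a \<Rightarrow> 'a \<Rightarrow> real) \<Rightarrow> ('a \<Rightarrow> real) \<Rightarrow> bool"
  where "stationary_distribution F q p \<longleftrightarrow>
    (\<forall>x\<in>F. 0 \<le> p x) \<and> (p has_sum 1) F \<and> (\<forall>y\<in>F. ((\<lambda>x. p x * q x y) has_sum 0) F)"

text \<open>The last-column-block-augmented truncation. The sum runs over levels \<open>m > n \<ge> 1\<close>, which
  all have the same set of phases.\<close>

definition lc_truncation :: "nat \<Rightarrow> (state \<Rightarrow> state \<Rightarrow> real) \<Rightarrow> state \<Rightarrow> state \<Rightarrow> real"
  where "lc_truncation n q = (\<lambda>(k, i) (l, j).
    if l < n then q (k, i) (l, j)
    else if l = n then q (k, i) (n, j) + (\<Sum>\<^sub>\<infinity>m\<in>{m. n < m \<and> m \<noteq> k}. q (k, i) (m, j))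
    else if k = l then q (k, i) (k, j)
    else 0)"


section \<open>Regular-jump Markov chains\<close>

text \<open>A chain is given by the laws \<open>Pr x\<close> under which it starts from \<open>x\<close>, and by \<open>X t\<close> for
  \<open>t \<ge> 0\<close>.\<close>

definition trans_prob :: "('a \<Rightarrow> 'w measure) \<Rightarrow> (real \<Rightarrow> 'w \<Rightarrow> 'a) \<Rightarrow> real \<Rightarrow> 'a \<Rightarrow> 'a \<Rightarrow> real"
  where "trans_prob Pr X t x y = measure (Pr x) {\<omega> \<in> space (Pr x). X t \<omega> = y}"

text \<open>The Markov property is written without conditional probabilities: \<open>a\<close> is the state at the
  present time \<open>s\<close>, and \<open>y\<close> prescribes the states at a finite set \<open>I\<close> of earlier times.\<close>

definition markov_chain :: "'a set \<Rightarrow> ('a \<Rightarrow> 'w measure) \<Rightarrow> (real \<Rightarrow> 'w \<Rightarrow> 'a) \<Rightarrow> bool"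
  where "markov_chain F Pr X \<longleftrightarrow> (\<forall>x\<in>F.
    prob_space (Pr x) \<and>
    (\<forall>t\<ge>0. X t \<in> measurable (Pr x) (count_space F)) \<and>
    (AE \<omega> in Pr x. X 0 \<omega> = x) \<and>
    (\<forall>s\<ge>0. \<forall>t\<ge>0. \<forall>I y. \<forall>a\<in>F. \<forall>z\<in>F. finite I \<and> I \<subseteq> {0..s} \<longrightarrow>
      measure (Pr x) {\<omega> \<in> space (Pr x). (\<forall>u\<in>I. X u \<omega> = y u) \<and> X s \<omega> = a \<and> X (s + t) \<omega> = z} =
      measure (Pr x) {\<omega> \<in> space (Pr x). (\<forall>u\<in>I. X u \<omega> = y u) \<and> X s \<omega> = a} * trans_prob Pr X t a z))"

text \<open>Almost surely the path is a right-continuous step function with finitely many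
  discontinuities in every bounded time interval, that is, it does not explode.\<close>

definition regular_jump_paths :: "'a set \<Rightarrow> ('a \<Rightarrow> 'w measure) \<Rightarrow> (real \<Rightarrow> 'w \<Rightarrow> 'a) \<Rightarrow> bool"
  where "regular_jump_paths F Pr X \<longleftrightarrow> (\<forall>x\<in>F. AE \<omega> in Pr x.
    (\<forall>t\<ge>0. \<forall>\<^sub>F s in at_right t. X s \<omega> = X t \<omega>) \<and>
    (\<forall>c>0. finite {t \<in> {0<..c}. \<not> (\<forall>\<^sub>F s in at t. X s \<omega> = X t \<omega>)}))"

definition has_generator ::
    "'a set \<Rightarrow> ('a \<Rightarrow> 'w measure) \<Rightarrow> (real \<Rightarrow> 'w \<Rightarrow> 'a) \<Rightarrow> ('a \<Rightarrow> 'a \<Rightarrow> real) \<Rightarrow> bool"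
  where "has_generator F Pr X q \<longleftrightarrow> (\<forall>x\<in>F. \<forall>y\<in>F.
    ((\<lambda>t. (trans_prob Pr X t x y - (if x = y then 1 else 0)) / t) \<longlongrightarrow> q x y) (at_right 0))"

text \<open>The first time at which the path is in \<open>x\<close> after having been outside \<open>x\<close>; infinite if
  there is no such time.\<close>

definition return_time :: "(real \<Rightarrow> 'w \<Rightarrow> 'a) \<Rightarrow> 'a \<Rightarrow> 'w \<Rightarrow> ennreal"
  where "return_time X x \<omega> = Inf {ennreal t | t. X t \<omega> = x \<and> (\<exists>s. 0 \<le> s \<and> s < t \<and> X s \<omega> \<noteq> x)}"

definition positive_recurrent :: "'a set \<Rightarrow> ('a \<Rightarrow> 'w measure) \<Rightarrow> (real \<Rightarrow> 'w \<Rightarrow> 'a) \<Rightarrow> bool"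
  where "positive_recurrent F Pr X \<longleftrightarrow> (\<forall>x\<in>F. (\<integral>\<^sup>+\<omega>. return_time X x \<omega> \<partial>Pr x) < \<infinity>)"

definition ergodic_regular_jump_chain ::
    "'a set \<Rightarrow> ('a \<Rightarrow> 'w measure) \<Rightarrow> (real \<Rightarrow> 'w \<Rightarrow> 'a) \<Rightarrow> ('a \<Rightarrow> 'a \<Rightarrow> real) \<Rightarrow> bool"
  where "ergodic_regular_jump_chain F Pr X q \<longleftrightarrow>
    markov_chain F Pr X \<and> regular_jump_paths F Pr X \<and>
    conservative_q_matrix F q \<and> has_generator F Pr X q \<and>
    irreducible_q F q \<and> positive_recurrent F Pr X"


section \<open>Drift condition and weighted norms\<close>

text \<open>Since \<open>v \<ge> 0\<close>, the row sums of \<open>Q v\<close> always exist in \<open>(-\<infinity>, \<infinity>]\<close>. The summability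
  requirement says that they are finite, which the inequality presupposes.\<close>

definition drift_condition ::
    "'a set \<Rightarrow> ('a \<Rightarrow> 'a \<Rightarrow> real) \<Rightarrow> ('a \<Rightarrow> real) \<Rightarrow> ('a \<Rightarrow> real) \<Rightarrow> real \<Rightarrow> 'a set \<Rightarrow> bool"
  where "drift_condition F q v f b C \<longleftrightarrow> (\<forall>x\<in>F.
    (\<lambda>y. q x y * v y) summable_on F \<and>
    (\<Sum>\<^sub>\<infinity>y\<in>F. q x y * v y) \<le> - f x + b * indicator C x)"

text \<open>In \<open>ennreal\<close> a positive number divided by \<open>0\<close> is \<open>\<infinity>\<close>, so for \<open>f \<ge> 1\<close> finiteness of this
  supremum entails \<open>v > 0\<close>.\<close>

definition sup_ratio :: "'a set \<Rightarrow> ('a \<Rightarrow> real) \<Rightarrow> ('a \<Rightarrow> real) \<Rightarrow> ennreal"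
  where "sup_ratio F f v = (SUP x\<in>F. ennreal (f x) / ennreal (v x))"

text \<open>The product of a nonnegative row vector and a nonnegative column vector.\<close>

definition pairing :: "'a set \<Rightarrow> ('a \<Rightarrow> real) \<Rightarrow> ('a \<Rightarrow> real) \<Rightarrow> ennreal"
  where "pairing F p g = (\<Sum>\<^sub>\<infinity>x\<in>F. ennreal (p x * g x))"

text \<open>The supremum of \<open>|p - p'| g / (p g)\<close> over the vectors \<open>g\<close> with \<open>l \<le> g \<le> u\<close>.\<close>

definition sup_rel_error ::
    "'a set \<Rightarrow> ('a \<Rightarrow> real) \<Rightarrow> ('a \<Rightarrow> real) \<Rightarrow> ('a \<Rightarrow> real) \<Rightarrow> ('a \<Rightarrow> real) \<Rightarrow> ennreal"
  where "sup_rel_error F p p' l u =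
    (SUP g\<in>{g. \<forall>x\<in>F. l x \<le> g x \<and> g x \<le> u x}.
      pairing F (\<lambda>x. \<bar>p x - p' x\<bar>) g / pairing F p g)"

definition reweight :: "'a set \<Rightarrow> ('a \<Rightarrow> real) \<Rightarrow> ('a \<Rightarrow> real) \<Rightarrow> 'a \<Rightarrow> real"
  where "reweight F w p = (\<lambda>x. p x * w x / (\<Sum>\<^sub>\<infinity>y\<in>F. p y * w y))"

text \<open>In the statement the test vectors for the reweighted distributions range over
  \<open>[min 1 (v / f), v]\<close>. A vector \<open>g\<close> with \<open>1 \<le> g \<le> f\<close> for the original distributions
  corresponds to \<open>(v / f) g\<close> for the reweighted ones, so the vectors in \<open>[v / f, v]\<close> have to be
  included. If \<open>f \<le> v\<close>, they lie in \<open>[1, v]\<close>, which is then the whole range. Without \<open>f \<le> v\<close>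
  a bound over \<open>[1, v]\<close> alone does not suffice. Consider the chain on \<open>{0, 1, 2, \<dots>}\<close> with
  rate \<open>1\<close> from every \<open>k\<close> to \<open>k + 1\<close>, rate \<open>1/10\<close> from \<open>1\<close> to \<open>0\<close>, rate \<open>1000\<close> from \<open>2\<close> to
  \<open>0\<close>, and rate \<open>1000\<close> from \<open>k\<close> to \<open>k - 1\<close> for \<open>k \<ge> 3\<close>. Take \<open>v k = 1 + k / 999\<close>,
  \<open>f 1 = f 2 = 1000\<close>, \<open>f k = 1\<close> otherwise, \<open>K = 2\<close> and \<open>b = 1001\<close>. For \<open>n = 1\<close> the supremum
  over \<open>[1, v]\<close> is below \<open>1/200\<close>, but \<open>|\<pi> - \<pi>\<^sub>1| e\<close> exceeds \<open>4/5\<close>.\<close>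

end

theory Submission
  imports Defs
begin

text \<open>Write \<open>w = f / v\<close>, and let \<open>r\<close> be the quotient of \<open>\<pi> w\<close> by \<open>\<pi>\<^sub>n w\<close>. Up to
  the common factor \<open>\<pi> w\<close>, the difference of the two reweighted distributions is
  \<open>(\<pi> - r \<pi>\<^sub>n) w\<close>. Testing it against \<open>g / w\<close> turns the hypothesis on \<open>E\<close> into
  \<open>|\<pi> - r \<pi>\<^sub>n| g \<le> E \<pi> g\<close> for all \<open>g\<close> between \<open>1\<close> and \<open>f\<close> (\<open>scaled_error\<close>). For \<open>g = 1\<close>
  this yields \<open>|1 - r| \<le> E\<close>, since both distributions have mass one. The triangle inequality
  then gives \<open>|\<pi> - \<pi>\<^sub>n| g \<le> E (\<pi> g + \<pi>\<^sub>n g)\<close> (\<open>pairing_error\<close>). For \<open>g = 1\<close> this is the bound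
  \<open>2 E\<close>. In general it remains to bound \<open>\<pi>\<^sub>n g\<close> by a multiple of \<open>\<pi> g\<close>, in one of two ways:
  \<^item> \<open>r \<pi>\<^sub>n g \<le> (1 + E) \<pi> g\<close>, where \<open>r \<ge> 1 - E\<close>, and \<open>r \<ge> 1 / (bh C)\<close> because
    \<open>\<pi>\<^sub>n w \<le> C\<close> and \<open>\<pi> w \<ge> 1 / bh\<close>; the last inequality follows from \<open>b \<pi>(F\<^sub>K) \<ge> \<pi> f \<ge> 1\<close>.
  \<^item> If \<open>v\<close> is level-wise nondecreasing, \<open>\<pi>\<^sub>n g \<le> \<pi>\<^sub>n f \<le> b \<le> b \<pi> g\<close>.

  Both use that a stationary distribution \<open>p\<close> of a nonexplosive \<open>Q\<close> satisfies
  \<open>p f \<le> b p(A)\<close> whenever \<open>Q v \<le> - f + b 1\<^sub>A\<close> (\<open>stationary_drift_bound\<close>).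
  This is the substantial part. Formally one multiplies the drift inequality by \<open>p\<close> and uses \<open>p Q v = 0\<close>, but nothing is known about the
  integrability of \<open>v\<close> or of the rates. The proof therefore replaces \<open>v\<close> by finitely supported
  test functions, which are obtained by cutting off \<open>v\<close> along functions \<open>e\<^sub>k\<close> with \<open>Q e\<^sub>k \<le> e\<^sub>k\<close>
  that equal \<open>1\<close> outside a finite set and tend to \<open>0\<close>. The existence of such functions
  expresses that the chain does not explode. For the original chain they come from its path
  properties: if \<open>0 \<le> w \<le> 1\<close> and \<open>w \<le> Q w\<close>, then \<open>exp (- t) w(X\<^sub>t)\<close> is a submartingale until
  the path leaves a given finite set; as the path on a bounded time interval visits only finitely
  many states, \<open>w = 0\<close> (\<open>regular_jump_no_bounded_growth\<close>). For the truncated chain they are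
  indicators, because every \<open>F\<^sub>m\<close> with \<open>m \<ge> n\<close> is closed.\<close>

section \<open>Sums over countable sets\<close>

lemma infsum_dominated_convergence:
  fixes f :: "nat \<Rightarrow> 'a \<Rightarrow> real"
  assumes "g summable_on A"
    and "\<And>k x. x \<in> A \<Longrightarrow> \<bar>f k x\<bar> \<le> g x"
    and "\<And>x. x \<in> A \<Longrightarrow> (\<lambda>k. f k x) \<longlonglongrightarrow> l x"
  shows "(\<lambda>k. \<Sum>\<^sub>\<infinity>x\<in>A. f k x) \<longlonglongrightarrow> (\<Sum>\<^sub>\<infinity>x\<in>A. l x)"
proof (rule swap_uniform_limit')
  have bound: "norm (l x) \<le> g x" if "x \<in> A" for x
    using LIMSEQ_le_const2[OF tendsto_norm[OF assms(3)[OF that]]] assms(2)[OF that] by auto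
  have "l summable_on A"
    by (rule Infinite_Sum.abs_summable_summable, rule Infinite_Sum.abs_summable_on_comparison_test'[OF assms(1) bound])
  then show "((\<lambda>Y. \<Sum>x\<in>Y. l x) \<longlongrightarrow> (\<Sum>\<^sub>\<infinity>x\<in>A. l x)) (finite_subsets_at_top A)"
    by (rule infsum_tendsto)
  show "uniform_limit UNIV (\<lambda>Y k. \<Sum>x\<in>Y. f k x) (\<lambda>k. \<Sum>\<^sub>\<infinity>x\<in>A. f k x)
          (finite_subsets_at_top A)"
    by (rule Weierstrass_m_test_general[OF _ assms(1)]) (use assms(2) in auto)
  show "\<forall>\<^sub>F Y in finite_subsets_at_top A. (\<lambda>k. \<Sum>x\<in>Y. f k x) \<longlonglongrightarrow> (\<Sum>x\<in>Y. l x)"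
    by (rule eventually_finite_subsets_at_top_weakI)
      (auto intro!: tendsto_sum assms(3))
qed auto

lemma has_sum_sum:
  fixes f :: "'b \<Rightarrow> 'a \<Rightarrow> 'c::topological_comm_monoid_add"
  assumes "finite D" and "\<And>y. y \<in> D \<Longrightarrow> (f y has_sum s y) A"
  shows "((\<lambda>x. \<Sum>y\<in>D. f y x) has_sum (\<Sum>y\<in>D. s y)) A"
  using assms by (induction D rule: finite_induct) (auto intro!: has_sum_add)

lemma has_sum_diff:
  fixes f g :: "'a \<Rightarrow> real"
  assumes "(f has_sum a) A" "(g has_sum c) A"
  shows "((\<lambda>x. f x - g x) has_sum (a - c)) A"
  using has_sum_add[OF assms(1) has_sum_uminusI[OF assms(2)]] by simp

lemma summable_on_mult_bounded:
  fixes a u :: "'a \<Rightarrow> real"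
  assumes "a summable_on F" and "\<And>x. x \<in> F \<Longrightarrow> \<bar>u x\<bar> \<le> B"
  shows "(\<lambda>x. a x * u x) summable_on F"
proof (rule Infinite_Sum.abs_summable_summable, rule Infinite_Sum.abs_summable_on_comparison_test')
  show "(\<lambda>x. \<bar>a x\<bar> * B) summable_on F"
    using assms(1) summable_on_iff_abs_summable_on_real[of a F]
    by (intro summable_on_cmult_left) auto
  show "norm (a x * u x) \<le> \<bar>a x\<bar> * B" if "x \<in> F" for x
    using assms(2)[OF that] by (auto simp: abs_mult intro!: mult_left_mono)
qed

lemma pairing_eq_infsum:
  assumes "\<And>x. x \<in> F \<Longrightarrow> 0 \<le> p x * g x" and "(\<lambda>x. p x * g x) summable_on F"
  shows "pairing F p g = ennreal (\<Sum>\<^sub>\<infinity>x\<in>F. p x * g x)"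
proof -
  have "sum (\<lambda>x. ennreal (p x * g x)) G = ennreal (\<Sum>x\<in>G. p x * g x)" if "G \<subseteq> F" for G
    by (rule sum_ennreal) (use that assms(1) in auto)
  then have "pairing F p g = (SUP G\<in>{G. finite G \<and> G \<subseteq> F}. ennreal (\<Sum>x\<in>G. p x * g x))"
    unfolding pairing_def
    by (subst nonneg_infsum_complete) (auto intro!: SUP_cong)
  also have "\<dots> = ennreal (\<Sum>\<^sub>\<infinity>x\<in>F. p x * g x)"
    by (rule infsum_nonneg_is_SUPREMUM_ennreal[symmetric]) (use assms in auto)
  finally show ?thesis .
qed

lemma summable_on_if_pairing_finite:
  assumes "\<And>x. x \<in> F \<Longrightarrow> 0 \<le> p x * g x" and "pairing F p g \<le> ennreal B" and "0 \<le> B"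
  shows "(\<lambda>x. p x * g x) summable_on F" and "(\<Sum>\<^sub>\<infinity>x\<in>F. p x * g x) \<le> B"
proof -
  have fin: "(\<Sum>x\<in>G. p x * g x) \<le> B" if "finite G" "G \<subseteq> F" for G
  proof -
    have "ennreal (\<Sum>x\<in>G. p x * g x) = (\<Sum>x\<in>G. ennreal (p x * g x))"
      by (rule sum_ennreal[symmetric]) (use that assms(1) in auto)
    also have "\<dots> = (\<Sum>\<^sub>\<infinity>x\<in>G. ennreal (p x * g x))"
      using that by simp
    also have "\<dots> \<le> pairing F p g"
      unfolding pairing_def by (rule infsum_mono_neutral) (use that in \<open>auto intro: nonneg_summable_on_complete\<close>)
    finally have "ennreal (\<Sum>x\<in>G. p x * g x) \<le> ennreal B"
      using assms(2) by (rule order_trans)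
    then show ?thesis using assms(3) by simp
  qed
  show s: "(\<lambda>x. p x * g x) summable_on F"
    by (rule nonneg_bdd_above_summable_on) (use fin assms(1) in \<open>auto intro!: bdd_aboveI2[where M=B]\<close>)
  show "(\<Sum>\<^sub>\<infinity>x\<in>F. p x * g x) \<le> B"
    by (rule infsum_le_finite_sums[OF s fin])
qed

section \<open>Generators acting on functions\<close>

abbreviation gen_apply :: "'a set \<Rightarrow> ('a \<Rightarrow> 'a \<Rightarrow> real) \<Rightarrow> ('a \<Rightarrow> real) \<Rightarrow> 'a \<Rightarrow> real"
  where "gen_apply F q u x \<equiv> (\<Sum>\<^sub>\<infinity>y\<in>F. q x y * u y)"

lemma row_summable:
  assumes "conservative_q_matrix F q" "x \<in> F"
  shows "q x summable_on F"
  using assms unfolding conservative_q_matrix_def by (metis has_sum_imp_summable)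

lemma row_mult_bounded_summable:
  assumes "conservative_q_matrix F q" "x \<in> F" "\<And>y. y \<in> F \<Longrightarrow> \<bar>u y\<bar> \<le> B"
  shows "(\<lambda>y. q x y * u y) summable_on F"
  by (rule summable_on_mult_bounded[OF row_summable[OF assms(1,2)] assms(3)])

lemma gen_apply_const:
  assumes "conservative_q_matrix F q" "x \<in> F"
  shows "gen_apply F q (\<lambda>_. c) x = 0"
proof -
  have "(q x has_sum 0) F" using assms unfolding conservative_q_matrix_def by auto
  from has_sum_cmult_left[OF this, of c] show ?thesis by (simp add: infsumI)
qed

text \<open>Off-diagonal rates are nonnegative, so raising a function away from \<open>x\<close> raises its image
  at \<open>x\<close>. This is the maximum principle in all its uses below.\<close>

lemma gen_apply_mono:
  assumes "conservative_q_matrix F q" "x \<in> F" "u x = u' x"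
    and "\<And>y. y \<in> F \<Longrightarrow> u y \<le> u' y"
    and "(\<lambda>y. q x y * u y) summable_on F" "(\<lambda>y. q x y * u' y) summable_on F"
  shows "gen_apply F q u x \<le> gen_apply F q u' x"
proof (rule infsum_mono[OF assms(5,6)])
  fix y assume "y \<in> F"
  show "q x y * u y \<le> q x y * u' y"
  proof (cases "y = x")
    case False
    then have "0 \<le> q x y" using assms(1,2) \<open>y \<in> F\<close> unfolding conservative_q_matrix_def by auto
    then show ?thesis using assms(4)[OF \<open>y \<in> F\<close>] by (simp add: mult_left_mono)
  qed (use assms(3) in simp)
qed

section \<open>Exit barriers and the drift inequality for stationary distributions\<close>

text \<open>A probabilistic example is \<open>e k x = E\<^sub>x exp (- T)\<close>, with \<open>T\<close> the exit time from
  the \<open>k\<close>-th member of an exhausting sequence of finite sets; that it tends to \<open>0\<close>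
  says that the chain does not explode.\<close>

definition exit_barrier :: "'a set \<Rightarrow> ('a \<Rightarrow> 'a \<Rightarrow> real) \<Rightarrow> (nat \<Rightarrow> 'a \<Rightarrow> real) \<Rightarrow> bool"
  where "exit_barrier F q e \<longleftrightarrow>
    (\<forall>k. \<forall>x\<in>F. 0 \<le> e k x \<and> e k x \<le> 1 \<and> gen_apply F q (e k) x \<le> e k x) \<and>
    (\<forall>k. finite {x \<in> F. e k x \<noteq> 1}) \<and> (\<forall>x\<in>F. (\<lambda>k. e k x) \<longlonglongrightarrow> 0)"

text \<open>The test function is the positive part \<open>\<phi>\<close> of \<open>N (1 - e) - v\<close>, which vanishes
  where \<open>e = 1\<close>. Where it is positive, the maximum principle, the drift condition and
  \<open>Q e \<le> e\<close> give \<open>Q \<phi> \<ge> f - b 1\<^sub>C - N e\<close>; elsewhere it has its minimum, so \<open>Q \<phi> \<ge> 0\<close>. Now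
  integrate with respect to \<open>p\<close>.\<close>

lemma stationary_drift_barrier:
  assumes q: "conservative_q_matrix F q" and p: "stationary_distribution F q p"
    and e: "\<And>x. x \<in> F \<Longrightarrow> 0 \<le> e x \<and> e x \<le> 1 \<and> gen_apply F q e x \<le> e x"
    and fin: "finite {x \<in> F. e x \<noteq> 1}"
    and v: "\<And>x. x \<in> F \<Longrightarrow> 0 \<le> v x" and f: "\<And>x. x \<in> F \<Longrightarrow> 0 \<le> f x" and b: "0 \<le> b"
    and drift: "drift_condition F q v f b C"
    and N: "0 < N" and G: "finite G" "G \<subseteq> F" "\<And>x. x \<in> G \<Longrightarrow> v x < N * (1 - e x)"
  shows "(\<Sum>x\<in>G. p x * f x) \<le> b * (\<Sum>\<^sub>\<infinity>x\<in>F. p x * indicator C x) + N * (\<Sum>\<^sub>\<infinity>x\<in>F. p x * e x)"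
proof -
  define \<phi> where "\<phi> x = max 0 (N * (1 - e x) - v x)" for x
  define D where "D = {x \<in> F. e x \<noteq> 1}"
  have D: "finite D" "D \<subseteq> F" using fin by (auto simp: D_def)
  have \<phi>0: "\<phi> x = 0" if "x \<in> F - D" for x
    using that v[of x] by (auto simp: \<phi>_def D_def)
  have psum: "p summable_on F" and p0: "\<And>x. x \<in> F \<Longrightarrow> 0 \<le> p x"
    using p unfolding stationary_distribution_def by (auto intro: has_sum_imp_summable)
  have \<phi>b: "\<bar>\<phi> x\<bar> \<le> N" if "x \<in> F" for x
  proof -
    have "N * (1 - e x) \<le> N" using mult_left_mono[of "1 - e x" 1 N] that e[of x] N by auto
    then show ?thesis using v[OF that] N unfolding \<phi>_def by linarith
  qed
  have \<phi>_ge0: "0 \<le> \<phi> x" for x by (simp add: \<phi>_def)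
  have Q\<phi>: "gen_apply F q \<phi> x = (\<Sum>y\<in>D. q x y * \<phi> y)" if "x \<in> F" for x
    using D \<phi>0 by (intro infsumI has_sum_finite_neutralI[of D]) auto
  \<comment> \<open>A finitely supported function permits the exchange of sums that stationarity needs.\<close>
  have "((\<lambda>x. \<Sum>y\<in>D. p x * q x y * \<phi> y) has_sum (\<Sum>y\<in>D. 0 * \<phi> y)) F"
    using p D by (intro has_sum_sum has_sum_cmult_left) (auto simp: stationary_distribution_def)
  then have zero: "((\<lambda>x. p x * gen_apply F q \<phi> x) has_sum 0) F"
    by (subst has_sum_cong[where g = "\<lambda>x. \<Sum>y\<in>D. p x * q x y * \<phi> y"])
      (auto simp: Q\<phi> sum_distrib_left mult.assoc)
  have low: "f x * indicator G x - b * indicator C x - N * e x \<le> gen_apply F q \<phi> x"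
    if x: "x \<in> F" for x
  proof -
    have s\<phi>: "(\<lambda>y. q x y * \<phi> y) summable_on F"
      by (rule row_mult_bounded_summable[OF q x \<phi>b])
    show ?thesis
    proof (cases "\<phi> x = 0")
      case True
      have "gen_apply F q (\<lambda>_. 0) x \<le> gen_apply F q \<phi> x"
        by (rule gen_apply_mono[OF q x])
          (use True s\<phi> in \<open>auto simp: \<phi>_ge0\<close>)
      moreover have "x \<notin> G" using G(3)[of x] True by (auto simp: \<phi>_def)
      moreover have "0 \<le> b * indicator C x" "0 \<le> N * e x" using b N e[OF x] by auto
      ultimately show ?thesis by simp
    next
      case False
      have se: "(\<lambda>y. q x y * e y) summable_on F"
        by (rule row_mult_bounded_summable[OF q x, of _ 1]) (use e in force)
      have sv: "(\<lambda>y. q x y * v y) summable_on F"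
        and dv: "gen_apply F q v x \<le> - f x + b * indicator C x"
        using drift x unfolding drift_condition_def by auto
      have s1: "(\<lambda>y. q x y * N) summable_on F"
        by (intro summable_on_cmult_left row_summable[OF q x])
      have "((\<lambda>y. q x y * N - N * (q x y * e y) - q x y * v y) has_sum
          (gen_apply F q (\<lambda>_. N) x - N * gen_apply F q e x - gen_apply F q v x)) F"
        by (intro has_sum_diff has_sum_cmult_right has_sum_infsum s1 se sv)
      then have hs: "((\<lambda>y. q x y * (N * (1 - e y) - v y)) has_sum
          (- N * gen_apply F q e x - gen_apply F q v x)) F"
        unfolding gen_apply_const[OF q x] by (simp add: algebra_simps)
      have "- N * gen_apply F q e x - gen_apply F q v x \<le> gen_apply F q \<phi> x"
        unfolding infsumI[OF hs, symmetric]
        by (rule gen_apply_mono[OF q x])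
          (use False s\<phi> has_sum_imp_summable[OF hs] in \<open>auto simp: \<phi>_def\<close>)
      moreover have "N * gen_apply F q e x \<le> N * e x"
        using e[OF x] N by (intro mult_left_mono) auto
      moreover have "f x * indicator G x \<le> f x"
        using f[OF x] by (auto simp: indicator_def)
      ultimately show ?thesis using dv by simp
    qed
  qed
  have sC: "(\<lambda>x. p x * indicator C x) summable_on F"
    by (rule summable_on_mult_bounded[OF psum, of _ 1]) (auto simp: indicator_def)
  have sE: "(\<lambda>x. p x * e x) summable_on F"
    by (rule summable_on_mult_bounded[OF psum, of _ 1]) (use e in force)
  have sG: "((\<lambda>x. p x * f x * indicator G x) has_sum (\<Sum>x\<in>G. p x * f x)) F"
    by (rule has_sum_finite_neutralI[of G]) (use G in auto)
  have "((\<lambda>x. p x * f x * indicator G x - b * (p x * indicator C x) - N * (p x * e x)) has_sum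
     ((\<Sum>x\<in>G. p x * f x) - b * (\<Sum>\<^sub>\<infinity>x\<in>F. p x * indicator C x) - N * (\<Sum>\<^sub>\<infinity>x\<in>F. p x * e x))) F"
    by (intro has_sum_diff has_sum_cmult_right has_sum_infsum sC sE sG)
  from has_sum_mono[OF this zero]
  have "(\<Sum>x\<in>G. p x * f x) - b * (\<Sum>\<^sub>\<infinity>x\<in>F. p x * indicator C x) - N * (\<Sum>\<^sub>\<infinity>x\<in>F. p x * e x) \<le> 0"
    using mult_left_mono[OF low p0] by (simp add: algebra_simps)
  then show ?thesis by simp
qed

text \<open>A finite set lies in the region \<open>v < N (1 - e\<^sub>k)\<close> once \<open>N\<close> exceeds \<open>v\<close> on it
  and \<open>k\<close> is large; the error term \<open>N (p e\<^sub>k)\<close> disappears as \<open>k\<close> grows, because \<open>p\<close> is finite.\<close>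

lemma stationary_drift_bound:
  assumes q: "conservative_q_matrix F q" and p: "stationary_distribution F q p"
    and e: "exit_barrier F q e"
    and v: "\<And>x. x \<in> F \<Longrightarrow> 0 \<le> v x" and f: "\<And>x. x \<in> F \<Longrightarrow> 0 \<le> f x" and b: "0 \<le> b"
    and drift: "drift_condition F q v f b C"
  shows "(\<lambda>x. p x * f x) summable_on F"
    and "(\<Sum>\<^sub>\<infinity>x\<in>F. p x * f x) \<le> b * (\<Sum>\<^sub>\<infinity>x\<in>F. p x * indicator C x)"
proof -
  have psum: "p summable_on F" and p0: "\<And>x. x \<in> F \<Longrightarrow> 0 \<le> p x"
    using p unfolding stationary_distribution_def by (auto intro: has_sum_imp_summable)
  have ek: "0 \<le> e k x \<and> e k x \<le> 1 \<and> gen_apply F q (e k) x \<le> e k x" if "x \<in> F" for k x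
    using e that unfolding exit_barrier_def by auto
  have bound: "(\<Sum>x\<in>G. p x * f x) \<le> b * (\<Sum>\<^sub>\<infinity>x\<in>F. p x * indicator C x)"
    if G: "finite G" "G \<subseteq> F" for G
  proof -
    define N where "N = 1 + Max (insert 0 (v ` G))"
    have "y \<le> Max (insert 0 (v ` G))" if "y \<in> insert 0 (v ` G)" for y
      using G(1) that by (intro Max_ge) auto
    from this[of 0] this[of "v _"] have N: "0 < N" "\<And>x. x \<in> G \<Longrightarrow> v x < N"
      by (auto simp: N_def less_eq_real_def add.commute intro: add_strict_increasing)
    have "\<forall>\<^sub>F k in sequentially. \<forall>x\<in>G. v x < N * (1 - e k x)"
    proof (rule eventually_ball_finite[OF G(1)], rule ballI)
      fix x assume x: "x \<in> G"
      have "(\<lambda>k. N * (1 - e k x)) \<longlonglongrightarrow> N * (1 - 0)"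
        by (intro tendsto_intros) (use e x G in \<open>auto simp: exit_barrier_def\<close>)
      then show "\<forall>\<^sub>F k in sequentially. v x < N * (1 - e k x)"
        using N(2)[OF x] by (intro order_tendstoD) auto
    qed
    then have ev: "\<forall>\<^sub>F k in sequentially. (\<Sum>x\<in>G. p x * f x) \<le>
        b * (\<Sum>\<^sub>\<infinity>x\<in>F. p x * indicator C x) + N * (\<Sum>\<^sub>\<infinity>x\<in>F. p x * e k x)"
    proof eventually_elim
      case (elim k)
      show ?case
        by (rule stationary_drift_barrier[OF q p ek _ v f b drift N(1) G])
          (use e elim in \<open>auto simp: exit_barrier_def\<close>)
    qed
    have lim0: "(\<lambda>k. \<Sum>\<^sub>\<infinity>x\<in>F. p x * e k x) \<longlonglongrightarrow> (\<Sum>\<^sub>\<infinity>x\<in>F. p x * 0)"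
    proof (rule infsum_dominated_convergence[OF psum])
      show "\<bar>p x * e k x\<bar> \<le> p x" if "x \<in> F" for k x
        using mult_left_mono[of "e k x" 1 "p x"] p0[OF that] ek[OF that, of k] by (auto simp: abs_mult)
      show "(\<lambda>k. p x * e k x) \<longlonglongrightarrow> p x * 0" if "x \<in> F" for x
        by (intro tendsto_intros) (use e that in \<open>auto simp: exit_barrier_def\<close>)
    qed
    have "(\<lambda>k. b * (\<Sum>\<^sub>\<infinity>x\<in>F. p x * indicator C x) + N * (\<Sum>\<^sub>\<infinity>x\<in>F. p x * e k x))
        \<longlonglongrightarrow> b * (\<Sum>\<^sub>\<infinity>x\<in>F. p x * indicator C x) + N * (\<Sum>\<^sub>\<infinity>x\<in>F. p x * 0)"
      by (intro tendsto_intros lim0)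
    from tendsto_lowerbound[OF this ev] show ?thesis by simp
  qed
  show s: "(\<lambda>x. p x * f x) summable_on F"
    by (rule nonneg_bdd_above_summable_on)
      (use bound p0 f in \<open>auto intro!: bdd_aboveI2\<close>)
  show "(\<Sum>\<^sub>\<infinity>x\<in>F. p x * f x) \<le> b * (\<Sum>\<^sub>\<infinity>x\<in>F. p x * indicator C x)"
    by (rule infsum_le_finite_sums[OF s bound])
qed

section \<open>Exit barriers from nonexplosion\<close>

lemma countable_finite_exhaustion:
  assumes "countable F"
  obtains A :: "nat \<Rightarrow> 'a set" where "\<And>k. finite (A k)" "incseq A" "(\<Union>k. A k) = F"
proof
  define A where "A k = {x \<in> F. to_nat_on F x < k}" for k
  show "finite (A k)" for k
    by (rule finite_imageD[of "to_nat_on F"])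
      (use inj_on_to_nat_on[OF assms] in \<open>auto simp: A_def intro: finite_subset[of _ "{..<k}"] inj_on_subset\<close>)
  show "incseq A" by (auto simp: A_def incseq_def)
  show "(\<Union>k. A k) = F" by (auto simp: A_def)
qed

lemma gen_apply_split:
  assumes q: "conservative_q_matrix F q" and x: "x \<in> F" and u: "\<And>y. y \<in> F \<Longrightarrow> \<bar>u y\<bar> \<le> B"
  shows "gen_apply F q u x = q x x * u x + (\<Sum>\<^sub>\<infinity>y\<in>F-{x}. q x y * u y)"
proof -
  have "(\<lambda>y. q x y * u y) summable_on F" by (rule row_mult_bounded_summable[OF q x u])
  then have "(\<lambda>y. q x y * u y) summable_on (F - {x})" by (rule summable_on_subset_banach) auto
  then have "infsum (\<lambda>y. q x y * u y) (insert x (F - {x})) = q x x * u x + (\<Sum>\<^sub>\<infinity>y\<in>F-{x}. q x y * u y)"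
    by (rule infsum_insert) auto
  then show ?thesis using x by (simp add: insert_absorb)
qed

text \<open>The hypothesis on \<open>w\<close> is Reuter's criterion for nonexplosion. The barrier is built
  by iterating the one-jump operator of \<open>Q e = e\<close> on growing finite sets, starting from \<open>1\<close>: its
  limit is a bounded solution of \<open>Q w = w\<close>, hence \<open>0\<close>.\<close>

lemma exit_barrier_if_no_bounded_growth:
  assumes F: "countable F" and q: "conservative_q_matrix F q"
    and no_growth: "\<And>w. (\<And>x. x \<in> F \<Longrightarrow> 0 \<le> w x \<and> w x \<le> 1 \<and> w x \<le> gen_apply F q w x) \<Longrightarrow>
      (\<And>x. x \<in> F \<Longrightarrow> w x = 0)"
  shows "\<exists>e. exit_barrier F q e"
proof -
  obtain A where A: "\<And>k. finite (A k)" "incseq A" "(\<Union>k. A k) = F"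
    using countable_finite_exhaustion[OF F] by blast
  define J where "J u x = (\<Sum>\<^sub>\<infinity>y\<in>F-{x}. q x y * u y)" for u x
  have off: "0 \<le> q x y" if "x \<in> F" "y \<in> F - {x}" for x y
    using q that unfolding conservative_q_matrix_def by auto
  have Jsum: "(\<lambda>y. q x y * u y) summable_on (F - {x})"
    if "x \<in> F" "\<And>y. y \<in> F \<Longrightarrow> 0 \<le> u y \<and> u y \<le> 1" for u x
    by (rule summable_on_subset_banach[OF row_mult_bounded_summable[OF q that(1), of u 1]])
      (use that(2) in force)+
  have J_mono: "J u x \<le> J u' x"
    if "x \<in> F" "\<And>y. y \<in> F \<Longrightarrow> 0 \<le> u y \<and> u y \<le> u' y \<and> u' y \<le> 1" for u u' x
    unfolding J_def
  proof (intro infsum_mono Jsum that(1))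
    show "q x y * u y \<le> q x y * u' y" if "y \<in> F - {x}" for y
      using that \<open>x \<in> F\<close> \<open>\<And>y. y \<in> F \<Longrightarrow> 0 \<le> u y \<and> u y \<le> u' y \<and> u' y \<le> 1\<close>[of y] off[of x y]
      by (intro mult_left_mono) auto
  qed (use that(2) in \<open>meson order_trans\<close>)+
  have split: "gen_apply F q u x = q x x * u x + J u x"
    if "x \<in> F" "\<And>y. y \<in> F \<Longrightarrow> 0 \<le> u y \<and> u y \<le> 1" for u x
    unfolding J_def by (rule gen_apply_split[OF q that(1), of u 1]) (use that(2) in force)
  have J1: "J (\<lambda>_. 1) x = - q x x" if "x \<in> F" for x
    using split[OF that, of "\<lambda>_. 1"] gen_apply_const[OF q that, of 1] by auto
  have diag: "q x x \<le> 0" if "x \<in> F" for x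
    using J1[OF that] infsum_nonneg[of "F - {x}" "\<lambda>y. q x y * 1"] off[OF that] by (auto simp: J_def)
  \<comment> \<open>\<open>J u x / (1 - q x x)\<close> is the expectation of \<open>exp (- T) * u Y\<close> for the exponential holding
    time \<open>T\<close> at \<open>x\<close> and the state \<open>Y\<close> after the jump.\<close>
  define e where "e = rec_nat (\<lambda>_. 1 :: real) (\<lambda>k u x. if x \<in> A k then J u x / (1 - q x x) else 1)"
  have e0: "e 0 x = 1" and eS: "e (Suc k) x = (if x \<in> A k then J (e k) x / (1 - q x x) else 1)" for k x
    by (simp_all add: e_def)
  have step: "(\<forall>x\<in>F. 0 \<le> e (Suc k) x \<and> e (Suc k) x \<le> e k x \<and> e k x \<le> 1) \<and>
      (\<forall>x. x \<notin> A k \<longrightarrow> e k x = 1)" for k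
  proof (induction k)
    case 0
    have "0 \<le> J (\<lambda>_. 1) x / (1 - q x x) \<and> J (\<lambda>_. 1) x / (1 - q x x) \<le> 1" if "x \<in> F" for x
      using J1[OF that] diag[OF that] by (auto simp: divide_simps)
    moreover have "e 0 = (\<lambda>_. 1)" by (auto simp: e0)
    ultimately show ?case by (auto simp: eS)
  next
    case (Suc k)
    have sub: "A k \<subseteq> A (Suc k)" using A(2) by (simp add: incseq_SucD)
    have e01: "0 \<le> e (Suc k) y \<and> e (Suc k) y \<le> e k y \<and> e k y \<le> 1" if "y \<in> F" for y
      using Suc that by auto
    have "0 \<le> e (Suc (Suc k)) x \<and> e (Suc (Suc k)) x \<le> e (Suc k) x \<and> e (Suc k) x \<le> 1" if x: "x \<in> F" for x
    proof (cases "x \<in> A (Suc k)")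
      case True
      have n: "0 \<le> J (e (Suc k)) x"
        unfolding J_def by (intro infsum_nonneg mult_nonneg_nonneg off[OF x]) (use e01 in auto)
      have m: "J (e (Suc k)) x \<le> J (e k) x" by (rule J_mono[OF x e01])
      have "J (e (Suc k)) x \<le> J (\<lambda>_. 1) x" by (rule J_mono[OF x]) (use e01 in force)
      then have "J (e (Suc k)) x / (1 - q x x) \<le> 1"
        using J1[OF x] diag[OF x] by (auto simp: divide_simps)
      moreover have "e (Suc k) x \<le> 1" using e01[OF x] by linarith
      ultimately show ?thesis
        using n m True diag[OF x] by (auto simp: eS intro!: divide_right_mono)
    next
      case False
      then show ?thesis using sub by (auto simp: eS)
    qed
    then show ?case using sub by (auto simp: eS)
  qed
  have e01: "0 \<le> e k x \<and> e k x \<le> 1" if "x \<in> F" for k x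
    using step[of k] that by force
  have ex: "gen_apply F q (e k) x \<le> e k x" if x: "x \<in> F" for k x
  proof -
    have spl: "gen_apply F q (e k) x = q x x * e k x + J (e k) x" by (rule split[OF x e01])
    show ?thesis
    proof (cases "e k x = 1")
      case True
      have "J (e k) x \<le> J (\<lambda>_. 1) x" by (rule J_mono[OF x]) (use e01 in force)
      then show ?thesis unfolding spl using True J1[OF x] by simp
    next
      case False
      then obtain j where j: "k = Suc j" using e0 by (cases k) auto
      with False have "x \<in> A j" by (auto simp: eS split: if_splits)
      then have "(1 - q x x) * e k x = J (e j) x" using diag[OF x] by (auto simp: j eS)
      moreover have "J (e k) x \<le> J (e j) x"
        by (rule J_mono[OF x]) (use step[of j] j in auto)
      ultimately show ?thesis unfolding spl by (simp add: algebra_simps)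
    qed
  qed
  have "\<exists>l. (\<lambda>k. e k x) \<longlonglongrightarrow> l" if "x \<in> F" for x
  proof -
    have "decseq (\<lambda>k. e k x)" by (rule decseq_SucI) (use step that in auto)
    moreover have "bdd_below (range (\<lambda>k. e k x))" using e01[OF that] by (auto intro!: bdd_belowI2[of _ 0])
    ultimately show ?thesis using LIMSEQ_decseq_INF by blast
  qed
  then obtain w where w: "\<And>x. x \<in> F \<Longrightarrow> (\<lambda>k. e k x) \<longlonglongrightarrow> w x" by metis
  have w01: "0 \<le> w x \<and> w x \<le> 1" if "x \<in> F" for x
    using LIMSEQ_le_const[OF w[OF that], of 0] LIMSEQ_le_const2[OF w[OF that], of 1] e01[OF that] by auto
  have "w x \<le> gen_apply F q w x" if x: "x \<in> F" for x
  proof -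
    obtain k0 where k0: "x \<in> A k0" using A(3) x by blast
    have ev: "\<forall>\<^sub>F k in sequentially. (1 - q x x) * e (Suc k) x = J (e k) x"
    proof (rule eventually_sequentiallyI[of k0])
      fix k assume "k0 \<le> k"
      then have "x \<in> A k" using A(2) k0 by (auto dest: incseqD)
      then show "(1 - q x x) * e (Suc k) x = J (e k) x" using diag[OF x] by (auto simp: eS)
    qed
    have lim1: "(\<lambda>k. (1 - q x x) * e (Suc k) x) \<longlonglongrightarrow> (1 - q x x) * w x"
      by (intro tendsto_intros LIMSEQ_Suc w x)
    have lim2: "(\<lambda>k. J (e k) x) \<longlonglongrightarrow> J w x"
      unfolding J_def
    proof (rule infsum_dominated_convergence[of "q x"])
      show "q x summable_on F - {x}"
        by (rule summable_on_subset_banach[OF row_summable[OF q x]]) auto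
      show "\<bar>q x y * e k y\<bar> \<le> q x y" if "y \<in> F - {x}" for k y
        using off[OF x that] e01[of y k] that mult_left_mono[of "e k y" 1 "q x y"]
        by (auto simp: abs_mult)
      show "(\<lambda>k. q x y * e k y) \<longlonglongrightarrow> q x y * w y" if "y \<in> F - {x}" for y
        by (intro tendsto_intros w) (use that in auto)
    qed
    have "(1 - q x x) * w x = J w x"
      using LIMSEQ_unique[OF lim1] lim2 tendsto_cong[OF ev] by blast
    moreover have "gen_apply F q w x = q x x * w x + J w x" by (rule split[OF x w01])
    ultimately show ?thesis by (simp add: algebra_simps)
  qed
  with no_growth w01 have "w x = 0" if "x \<in> F" for x using that by blast
  moreover have "finite {x \<in> F. e k x \<noteq> 1}" for k
    by (rule finite_subset[OF _ A(1)[of k]]) (use step[of k] in auto)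
  ultimately show ?thesis
    unfolding exit_barrier_def using e01 ex w by (intro exI[of _ e]) fastforce
qed

text \<open>Nothing leads out of \<open>D k\<close>, so a barrier may vanish on it.\<close>

lemma exit_barrier_finite_closed:
  assumes q: "conservative_q_matrix F q" and D: "\<And>k. finite (D k)" "\<And>k. D k \<subseteq> F" "incseq D" "(\<Union>k. D k) = F"
    and closed: "\<And>k x y. x \<in> D k \<Longrightarrow> y \<in> F - D k \<Longrightarrow> q x y = 0"
  shows "exit_barrier F q (\<lambda>k x. indicator (- D k) x)"
  unfolding exit_barrier_def
proof (intro conjI allI ballI)
  fix k x assume x: "x \<in> F"
  let ?e = "\<lambda>x. indicator (- D k) x :: real"
  show "0 \<le> ?e x" "?e x \<le> 1" by (auto simp: indicator_def)
  show "gen_apply F q ?e x \<le> ?e x"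
  proof (cases "x \<in> D k")
    case True
    have "gen_apply F q ?e x = (\<Sum>\<^sub>\<infinity>y\<in>F. 0)"
      by (rule infsum_cong) (use closed True in \<open>auto simp: indicator_def\<close>)
    then show ?thesis by (simp add: True)
  next
    case False
    have "gen_apply F q ?e x \<le> gen_apply F q (\<lambda>_. 1) x"
      by (rule gen_apply_mono[OF q x]; (rule row_mult_bounded_summable[OF q x, of _ 1])?)
        (use False in \<open>auto simp: indicator_def\<close>)
    then show ?thesis using False gen_apply_const[OF q x, of 1] by simp
  qed
next
  fix k show "finite {x \<in> F. indicator (- D k) x \<noteq> (1::real)}"
    by (rule finite_subset[OF _ D(1)[of k]]) (auto simp: indicator_def)
next
  fix x assume "x \<in> F"
  then obtain k0 where "x \<in> D k0" using D(4) by blast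
  then have "indicator (- D k) x = (0::real)" if "k0 \<le> k" for k
    using D(3) that by (auto simp: indicator_def dest: incseqD)
  then show "(\<lambda>k. indicator (- D k) x :: real) \<longlonglongrightarrow> 0"
    by (intro tendsto_eventually eventually_sequentiallyI[of k0])
qed

section \<open>Regular-jump chains do not explode\<close>

text \<open>Between two consecutive discontinuities the path is locally constant on a connected
  set. So, apart from its values at \<open>0\<close> and at the discontinuities, its value at \<open>t\<close> is a
  function of the set of discontinuities up to \<open>t\<close>.\<close>

lemma finite_range_step_path:
  fixes X :: "real \<Rightarrow> 'a"
  assumes "0 < c" and "finite {t \<in> {0<..c}. \<not> (\<forall>\<^sub>F s in at t. X s = X t)}"
  shows "finite (X ` {0..c})"
proof -
  define D where "D = {t \<in> {0<..c}. \<not> (\<forall>\<^sub>F s in at t. X s = X t)}"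
  define T where "T = {0<..c} - D"
  have D: "finite D" using assms(2) by (simp add: D_def)
  have const: "X s = X t" if "s \<in> T" "t \<in> T" "D \<inter> {..s} = D \<inter> {..t}" "s \<le> t" for s t
  proof (rule connected_local_const[of "{s..t}"])
    show "\<forall>a\<in>{s..t}. \<forall>\<^sub>F b in at a within {s..t}. X a = X b"
    proof
      fix a assume a: "a \<in> {s..t}"
      have "a \<notin> D"
      proof
        assume "a \<in> D"
        with a have "a \<in> D \<inter> {..s}" unfolding that(3) by simp
        with a have "a = s" by simp
        with \<open>a \<in> D\<close> that(1) show False by (simp add: T_def)
      qed
      with a that(1,2) have "\<forall>\<^sub>F b in at a. X b = X a" by (auto simp: D_def T_def)
      then have "\<forall>\<^sub>F b in at a within {s..t}. X b = X a"
        by (rule filter_leD[OF at_le[OF subset_UNIV]])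
      then show "\<forall>\<^sub>F b in at a within {s..t}. X a = X b" by eventually_elim simp
    qed
  qed (use that(4) in auto)
  have const': "X s = X t" if "s \<in> T" "t \<in> T" "D \<inter> {..s} = D \<inter> {..t}" for s t
  proof (cases "s \<le> t")
    case True
    then show ?thesis by (rule const[OF that])
  next
    case False
    then have "t \<le> s" by simp
    from const[OF that(2,1) that(3)[symmetric] this] show ?thesis by (rule sym)
  qed
  let ?g = "\<lambda>U. X (SOME t. t \<in> T \<and> D \<inter> {..t} = U)"
  have "X ` T \<subseteq> ?g ` Pow D"
  proof
    fix y assume "y \<in> X ` T"
    then obtain t where t: "t \<in> T" "y = X t" by blast
    have "?g (D \<inter> {..t}) = X t"
      by (rule const'[symmetric, OF t(1)]; rule someI2[of _ t]) (use t in auto)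
    with t(2) have "y = ?g (D \<inter> {..t})" by simp
    then show "y \<in> ?g ` Pow D" by (rule image_eqI) simp
  qed
  then have "finite (X ` T)" by (rule finite_subset) (simp add: D)
  moreover have "X ` {0..c} \<subseteq> insert (X 0) (X ` D \<union> X ` T)"
  proof
    fix y assume "y \<in> X ` {0..c}"
    then obtain t where t: "y = X t" "0 \<le> t" "t \<le> c" by auto
    then consider "t = 0" | "t \<in> D" | "t \<in> T" by (force simp: T_def)
    then show "y \<in> insert (X 0) (X ` D \<union> X ` T)" using t(1) by cases auto
  qed
  ultimately show ?thesis using D by (auto intro: finite_subset)
qed

text \<open>The Markov property conditions on single past states; summing over the possible pasts
  lets it condition on the event that the path was in \<open>A\<close> at the times in \<open>I\<close>.\<close>

lemma markov_taboo:
  assumes mc: "markov_chain F Pr X" and x: "x \<in> F" and A: "finite A" "A \<subseteq> F"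
    and I: "finite I" "I \<subseteq> {0..s}" and st: "0 \<le> s" "0 \<le> t" and az: "a \<in> F" "z \<in> F"
  shows "measure (Pr x) {\<omega> \<in> space (Pr x). (\<forall>u\<in>I. X u \<omega> \<in> A) \<and> X s \<omega> = a \<and> X (s + t) \<omega> = z}
    = measure (Pr x) {\<omega> \<in> space (Pr x). (\<forall>u\<in>I. X u \<omega> \<in> A) \<and> X s \<omega> = a} * trans_prob Pr X t a z"
proof -
  interpret prob_space "Pr x" using mc x unfolding markov_chain_def by blast
  let ?P = "PiE I (\<lambda>_. A)"
  have [measurable]: "X u \<in> measurable (Pr x) (count_space F)" if "0 \<le> u" for u
    using mc x that unfolding markov_chain_def by blast
  have [measurable]: "Measurable.pred (Pr x) (\<lambda>\<omega>. X u \<omega> = c)" if "0 \<le> u" for u c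
    by (rule measurable_compose[of "X u" _ "count_space F"]) (use that in auto)
  have [measurable]: "Measurable.pred (Pr x) (\<lambda>\<omega>. \<forall>u\<in>I. X u \<omega> = y u)" for y
    using I by (intro pred_intros_finite) auto
  have P: "finite ?P" by (rule finite_PiE) (use I A in auto)
  have decomp: "measure (Pr x) {\<omega> \<in> space (Pr x). (\<forall>u\<in>I. X u \<omega> \<in> A) \<and> R \<omega>} =
      (\<Sum>y\<in>?P. measure (Pr x) {\<omega> \<in> space (Pr x). (\<forall>u\<in>I. X u \<omega> = y u) \<and> R \<omega>})"
    if [measurable]: "Measurable.pred (Pr x) R" for R
  proof -
    have "{\<omega> \<in> space (Pr x). (\<forall>u\<in>I. X u \<omega> \<in> A) \<and> R \<omega>} =
        (\<Union>y\<in>?P. {\<omega> \<in> space (Pr x). (\<forall>u\<in>I. X u \<omega> = y u) \<and> R \<omega>})"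
    proof (intro equalityI subsetI)
      fix \<omega> assume "\<omega> \<in> {\<omega> \<in> space (Pr x). (\<forall>u\<in>I. X u \<omega> \<in> A) \<and> R \<omega>}"
      then show "\<omega> \<in> (\<Union>y\<in>?P. {\<omega> \<in> space (Pr x). (\<forall>u\<in>I. X u \<omega> = y u) \<and> R \<omega>})"
        by (intro UN_I[of "restrict (\<lambda>u. X u \<omega>) I"]) auto
    qed (auto simp: PiE_iff)
    moreover have "disjoint_family_on (\<lambda>y. {\<omega> \<in> space (Pr x). (\<forall>u\<in>I. X u \<omega> = y u) \<and> R \<omega>}) ?P"
      by (auto simp: disjoint_family_on_def) (metis PiE_ext)
    moreover have "(\<lambda>y. {\<omega> \<in> space (Pr x). (\<forall>u\<in>I. X u \<omega> = y u) \<and> R \<omega>}) ` ?P \<subseteq> sets (Pr x)"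
      by (intro image_subsetI) measurable
    ultimately show ?thesis
      using finite_measure_finite_Union[OF P] by presburger
  qed
  have st': "0 \<le> s + t" using st by simp
  have M: "measure (Pr x) {\<omega> \<in> space (Pr x). (\<forall>u\<in>I. X u \<omega> = y u) \<and> X s \<omega> = a \<and> X (s + t) \<omega> = z} =
      measure (Pr x) {\<omega> \<in> space (Pr x). (\<forall>u\<in>I. X u \<omega> = y u) \<and> X s \<omega> = a} * trans_prob Pr X t a z" for y
    using mc x st az I unfolding markov_chain_def by blast
  show ?thesis
    using st st' by (simp add: decomp M sum_distrib_right)
qed

text \<open>The chain is observed at the multiples of \<open>h\<close> and killed outside \<open>A\<close>. Up to \<open>h * \<epsilon>\<close>,
  the hypothesis \<open>step\<close> is a rearrangement of \<open>(1 + h) * w a \<le> E\<^sub>a (w X\<^sub>h; X\<^sub>h \<in> A) + P\<^sub>a (X\<^sub>h \<notin> A)\<close>: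
  the discounted value of \<open>w\<close> grows along the chain if killing is paid with \<open>1\<close>.\<close>

lemma taboo_chain_bound:
  assumes mc: "markov_chain F Pr X" and x: "x \<in> A" and A: "finite A" "A \<subseteq> F"
    and h: "0 \<le> h" and \<epsilon>: "0 \<le> \<epsilon>"
    and w: "\<And>a. a \<in> A \<Longrightarrow> 0 \<le> w a \<and> w a \<le> 1"
    and step: "\<And>a. a \<in> A \<Longrightarrow> (\<Sum>z\<in>A. trans_prob Pr X h a z * (1 - w z)) \<le> 1 - w a - h * w a + h * \<epsilon>"
  shows "w x \<le> 1 / (1 + h) ^ n + real n * h * \<epsilon> +
    (1 - measure (Pr x) {\<omega> \<in> space (Pr x). \<forall>i\<le>n. X (real i * h) \<omega> \<in> A})"
proof -
  have xF: "x \<in> F" using x A by blast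
  interpret prob_space "Pr x" using mc xF unfolding markov_chain_def by blast
  have [measurable]: "Measurable.pred (Pr x) (\<lambda>\<omega>. X u \<omega> \<in> B)" if "0 \<le> u" for u B
    by (rule measurable_compose[of "X u" _ "count_space F"])
      (use mc xF that in \<open>auto simp: markov_chain_def\<close>)
  have [measurable]: "Measurable.pred (Pr x) (\<lambda>\<omega>. X u \<omega> = c)" if "0 \<le> u" for u c
    by (rule measurable_compose[of "X u" _ "count_space F"])
      (use mc xF that in \<open>auto simp: markov_chain_def\<close>)
  have hn: "0 \<le> real i * h" for i using h by simp
  have in_A [measurable]: "Measurable.pred (Pr x) (\<lambda>\<omega>. \<forall>i\<le>n. X (real i * h) \<omega> \<in> A)" for n
    using hn by (intro pred_intros_countable) auto
  have ev: "Measurable.pred (Pr x) (\<lambda>\<omega>. X (real i * h) \<omega> = c)" for i c using hn by auto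
  define \<mu> where "\<mu> n a = measure (Pr x)
      {\<omega> \<in> space (Pr x). (\<forall>i\<le>n. X (real i * h) \<omega> \<in> A) \<and> X (real n * h) \<omega> = a}" for n a
  define mass where "mass n = measure (Pr x) {\<omega> \<in> space (Pr x). \<forall>i\<le>n. X (real i * h) \<omega> \<in> A}" for n
  have split: "measure (Pr x) {\<omega> \<in> space (Pr x). (\<forall>i\<le>n. X (real i * h) \<omega> \<in> A) \<and> R \<omega>} =
      (\<Sum>a\<in>A. measure (Pr x) {\<omega> \<in> space (Pr x). (\<forall>i\<le>n. X (real i * h) \<omega> \<in> A) \<and> X (real n * h) \<omega> = a \<and> R \<omega>})"
    if R: "Measurable.pred (Pr x) R" for n R
  proof -
    define P where "P \<omega> \<longleftrightarrow> (\<forall>i\<le>n. X (real i * h) \<omega> \<in> A)" for \<omega>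
    define Y where "Y \<omega> = X (real n * h) \<omega>" for \<omega>
    have PY: "Y \<omega> \<in> A" if "P \<omega>" for \<omega> using that by (simp add: P_def Y_def)
    have [measurable]: "Measurable.pred (Pr x) P" unfolding P_def by (rule in_A)
    have [measurable]: "Measurable.pred (Pr x) (\<lambda>\<omega>. Y \<omega> = c)" for c unfolding Y_def by (rule ev)
    note R [measurable]
    have "{\<omega> \<in> space (Pr x). P \<omega> \<and> R \<omega>} = (\<Union>a\<in>A. {\<omega> \<in> space (Pr x). P \<omega> \<and> Y \<omega> = a \<and> R \<omega>})"
      using PY by auto
    moreover have "disjoint_family_on (\<lambda>a. {\<omega> \<in> space (Pr x). P \<omega> \<and> Y \<omega> = a \<and> R \<omega>}) A"
      by (auto simp: disjoint_family_on_def)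
    moreover have "(\<lambda>a. {\<omega> \<in> space (Pr x). P \<omega> \<and> Y \<omega> = a \<and> R \<omega>}) ` A \<subseteq> sets (Pr x)"
      by (intro image_subsetI) measurable
    ultimately have "measure (Pr x) {\<omega> \<in> space (Pr x). P \<omega> \<and> R \<omega>} =
        (\<Sum>a\<in>A. measure (Pr x) {\<omega> \<in> space (Pr x). P \<omega> \<and> Y \<omega> = a \<and> R \<omega>})"
      using finite_measure_finite_Union[OF A(1)] by presburger
    then show ?thesis unfolding P_def Y_def .
  qed
  have mass: "mass n = (\<Sum>a\<in>A. \<mu> n a)" for n
    using split[of "\<lambda>_. True" n] by (simp add: mass_def \<mu>_def)
  have next_step: "\<mu> (Suc n) z = (\<Sum>a\<in>A. \<mu> n a * trans_prob Pr X h a z)" if z: "z \<in> A" for n z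
  proof -
    have "\<mu> (Suc n) z = measure (Pr x) {\<omega> \<in> space (Pr x).
        (\<forall>i\<le>n. X (real i * h) \<omega> \<in> A) \<and> X (real (Suc n) * h) \<omega> = z}"
      unfolding \<mu>_def by (rule arg_cong[of _ _ "measure (Pr x)"]) (use z in \<open>auto simp: le_Suc_eq\<close>)
    also have "\<dots> = (\<Sum>a\<in>A. measure (Pr x) {\<omega> \<in> space (Pr x).
        (\<forall>i\<le>n. X (real i * h) \<omega> \<in> A) \<and> X (real n * h) \<omega> = a \<and> X (real (Suc n) * h) \<omega> = z})"
      by (rule split[OF ev])
    also have "\<dots> = (\<Sum>a\<in>A. \<mu> n a * trans_prob Pr X h a z)"
    proof (rule sum.cong[OF refl])
      fix a assume a: "a \<in> A"
      let ?I = "(\<lambda>i. real i * h) ` {..n}"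
      have "?I \<subseteq> {0..real n * h}" using h by (auto intro!: mult_right_mono)
      from markov_taboo[OF mc xF A _ this hn h, of a z] a z A
      have "measure (Pr x) {\<omega> \<in> space (Pr x).
          (\<forall>u\<in>?I. X u \<omega> \<in> A) \<and> X (real n * h) \<omega> = a \<and> X (real n * h + h) \<omega> = z} =
        measure (Pr x) {\<omega> \<in> space (Pr x). (\<forall>u\<in>?I. X u \<omega> \<in> A) \<and> X (real n * h) \<omega> = a} *
        trans_prob Pr X h a z" by blast
      moreover have "(\<forall>u\<in>?I. X u \<omega> \<in> A) \<longleftrightarrow> (\<forall>i\<le>n. X (real i * h) \<omega> \<in> A)" for \<omega> by auto
      moreover have "real (Suc n) * h = real n * h + h" by (simp add: algebra_simps)
      ultimately show "measure (Pr x) {\<omega> \<in> space (Pr x).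
          (\<forall>i\<le>n. X (real i * h) \<omega> \<in> A) \<and> X (real n * h) \<omega> = a \<and> X (real (Suc n) * h) \<omega> = z} =
        \<mu> n a * trans_prob Pr X h a z"
        by (simp only: \<mu>_def)
    qed
    finally show ?thesis .
  qed
  have mass_dec: "mass (Suc n) \<le> mass n" for n
    unfolding mass_def
    by (rule finite_measure_mono[OF Collect_mono predE[OF in_A]]) (use le_SucI in blast)
  have mass1: "mass n \<le> 1" for n unfolding mass_def by (rule prob_le_1)
  have \<mu>0: "0 \<le> \<mu> n a" for n a unfolding \<mu>_def by simp
  define \<kappa> where "\<kappa> = 1 / (1 + h)"
  have \<kappa>: "0 < \<kappa>" "\<kappa> \<le> 1" "(1 + h) * \<kappa> = 1" using h by (auto simp: \<kappa>_def)
  have "w x \<le> \<kappa> ^ n * (\<Sum>a\<in>A. \<mu> n a * w a) + (1 - mass n) + real n * h * \<epsilon>"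
  proof (induction n)
    case 0
    have AE0: "AE \<omega> in Pr x. X 0 \<omega> = x" using mc xF unfolding markov_chain_def by blast
    have "\<mu> 0 x = measure (Pr x) (space (Pr x))"
      unfolding \<mu>_def by (rule finite_measure_eq_AE) (use AE0 x in \<open>auto intro!: predE\<close>)
    then have "\<mu> 0 x = 1" by (simp add: prob_space)
    moreover have "\<mu> 0 x * w x \<le> (\<Sum>a\<in>A. \<mu> 0 a * w a)"
      by (rule member_le_sum) (use x A w \<mu>0 in auto)
    ultimately show ?case using mass1[of 0] by simp
  next
    case (Suc n)
    have "(\<Sum>a\<in>A. \<mu> n a * (\<Sum>z\<in>A. trans_prob Pr X h a z * (1 - w z))) \<le>
        (\<Sum>a\<in>A. \<mu> n a * (1 - w a - h * w a + h * \<epsilon>))"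
      by (intro sum_mono mult_left_mono step \<mu>0)
    also have "(\<Sum>a\<in>A. \<mu> n a * (\<Sum>z\<in>A. trans_prob Pr X h a z * (1 - w z))) =
        (\<Sum>z\<in>A. \<mu> (Suc n) z * (1 - w z))"
      by (simp add: next_step sum_distrib_left sum_distrib_right mult.assoc) (rule sum.swap)
    also have "\<dots> = mass (Suc n) - (\<Sum>z\<in>A. \<mu> (Suc n) z * w z)"
      by (simp add: mass algebra_simps sum_subtractf)
    also have "(\<Sum>a\<in>A. \<mu> n a * (1 - w a - h * w a + h * \<epsilon>)) =
        mass n - (1 + h) * (\<Sum>a\<in>A. \<mu> n a * w a) + h * \<epsilon> * mass n"
      by (simp add: mass algebra_simps sum_subtractf sum.distrib sum_distrib_left)
    finally have "(1 + h) * (\<Sum>a\<in>A. \<mu> n a * w a) \<le>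
        (\<Sum>z\<in>A. \<mu> (Suc n) z * w z) + (mass n - mass (Suc n)) + h * \<epsilon> * mass n" by simp
    also have "h * \<epsilon> * mass n \<le> h * \<epsilon>" using mass1[of n] h \<epsilon> by (simp add: mult_left_le)
    finally have "\<kappa> ^ Suc n * ((1 + h) * (\<Sum>a\<in>A. \<mu> n a * w a)) \<le>
        \<kappa> ^ Suc n * ((\<Sum>z\<in>A. \<mu> (Suc n) z * w z) + ((mass n - mass (Suc n)) + h * \<epsilon>))"
      using \<kappa>(1) by (intro mult_left_mono) auto
    also have "\<dots> \<le> \<kappa> ^ Suc n * (\<Sum>z\<in>A. \<mu> (Suc n) z * w z) + ((mass n - mass (Suc n)) + h * \<epsilon>)"
    proof -
      have "\<kappa> ^ Suc n \<le> 1" using \<kappa> by (intro power_le_one) auto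
      moreover have "0 \<le> (mass n - mass (Suc n)) + h * \<epsilon>" using mass_dec[of n] h \<epsilon> by simp
      ultimately have "\<kappa> ^ Suc n * ((mass n - mass (Suc n)) + h * \<epsilon>) \<le> (mass n - mass (Suc n)) + h * \<epsilon>"
        using \<kappa>(1) by (intro mult_left_le_one_le) auto
      then show ?thesis by (simp add: distrib_left)
    qed
    also have "\<kappa> ^ Suc n * ((1 + h) * (\<Sum>a\<in>A. \<mu> n a * w a)) = \<kappa> ^ n * (\<Sum>a\<in>A. \<mu> n a * w a)"
      using \<kappa>(3) by (simp add: mult.assoc[symmetric] mult.commute)
    finally show ?case using Suc.IH by (simp add: algebra_simps)
  qed
  also have "\<kappa> ^ n * (\<Sum>a\<in>A. \<mu> n a * w a) \<le> \<kappa> ^ n * 1"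
  proof (rule mult_left_mono)
    have "(\<Sum>a\<in>A. \<mu> n a * w a) \<le> (\<Sum>a\<in>A. \<mu> n a)"
      by (intro sum_mono mult_left_le \<mu>0) (use w in auto)
    then show "(\<Sum>a\<in>A. \<mu> n a * w a) \<le> 1" using mass1[of n] mass by simp
  qed (use \<kappa> in auto)
  finally show ?thesis by (simp add: mass_def \<kappa>_def power_one_over)
qed

text \<open>On the finite set \<open>A\<close> the transition probabilities over a short time \<open>h\<close> are
  \<open>1 + h Q\<close> up to \<open>o(h)\<close>, so for \<open>h = t / n\<close> and large \<open>n\<close> the discrete bound applies to the
  generator. Bernoulli's inequality makes the discount factor uniform in \<open>n\<close>. Only rational times
  occur, which keeps the taboo event measurable.\<close>

lemma taboo_bound:
  assumes mc: "markov_chain F Pr X" and q: "conservative_q_matrix F q" and gen: "has_generator F Pr X q"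
    and x: "x \<in> A" and A: "finite A" "A \<subseteq> F" and t: "0 < t" "t \<in> \<rat>" and \<eta>: "0 < \<eta>"
    and w: "\<And>a. a \<in> F \<Longrightarrow> 0 \<le> w a \<and> w a \<le> 1 \<and> w a \<le> gen_apply F q w a"
  shows "w x \<le> 1 / (1 + t) + \<eta> +
    (1 - measure (Pr x) {\<omega> \<in> space (Pr x). \<forall>s\<in>\<rat> \<inter> {0..t}. X s \<omega> \<in> A})"
proof -
  have xF: "x \<in> F" using x A by blast
  interpret prob_space "Pr x" using mc xF unfolding markov_chain_def by blast
  have predX: "Measurable.pred (Pr x) (\<lambda>\<omega>. X u \<omega> \<in> B)" if "0 \<le> u" for u B
    by (rule measurable_compose[of "X u" _ "count_space F"])
      (use mc xF that in \<open>auto simp: markov_chain_def\<close>)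
  define \<epsilon> where "\<epsilon> = \<eta> / t"
  have \<epsilon>: "0 < \<epsilon>" using t \<eta> by (simp add: \<epsilon>_def)
  have QA: "(\<Sum>z\<in>A. q a z * (1 - w z)) \<le> - w a" if a: "a \<in> A" for a
  proof -
    have aF: "a \<in> F" using a A by blast
    have s1: "(\<lambda>z. q a z * w z) summable_on F"
      by (rule row_mult_bounded_summable[OF q aF, of _ 1]) (use w in force)
    have "(q a has_sum 0) F" using q aF unfolding conservative_q_matrix_def by blast
    from has_sum_diff[OF this has_sum_infsum[OF s1]]
    have hs: "((\<lambda>z. q a z * (1 - w z)) has_sum (- gen_apply F q w a)) F"
      by (simp add: algebra_simps)
    have "(\<Sum>z\<in>A. q a z * (1 - w z)) \<le> - gen_apply F q w a"
    proof (rule finite_sum_le_has_sum[OF hs A])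
      show "0 \<le> q a z * (1 - w z)" if "z \<in> F - A" for z
        using q aF a that w[of z] unfolding conservative_q_matrix_def by (intro mult_nonneg_nonneg) auto
    qed
    then show ?thesis using w[OF aF] by linarith
  qed
  have "\<forall>\<^sub>F h in at_right 0. \<forall>a\<in>A.
      (\<Sum>z\<in>A. trans_prob Pr X h a z * (1 - w z)) \<le> 1 - w a - h * w a + h * \<epsilon>"
  proof (rule eventually_ball_finite[OF A(1)], rule ballI)
    fix a assume a: "a \<in> A"
    have "((\<lambda>h. \<Sum>z\<in>A. (trans_prob Pr X h a z - (if a = z then 1 else 0)) / h * (1 - w z)) \<longlongrightarrow>
        (\<Sum>z\<in>A. q a z * (1 - w z))) (at_right 0)"
    proof (intro tendsto_sum tendsto_mult_right)
      show "((\<lambda>h. (trans_prob Pr X h a z - (if a = z then 1 else 0)) / h) \<longlongrightarrow> q a z) (at_right 0)"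
        if "z \<in> A" for z
        using gen a A that unfolding has_generator_def by blast
    qed
    moreover have "(\<Sum>z\<in>A. q a z * (1 - w z)) < - w a + \<epsilon>" using QA[OF a] \<epsilon> by linarith
    ultimately have "\<forall>\<^sub>F h in at_right 0.
        (\<Sum>z\<in>A. (trans_prob Pr X h a z - (if a = z then 1 else 0)) / h * (1 - w z)) < - w a + \<epsilon>"
      by (rule order_tendstoD)
    moreover have "\<forall>\<^sub>F h in at_right 0. (0::real) < h" by (rule eventually_at_right_less)
    ultimately show "\<forall>\<^sub>F h in at_right 0.
        (\<Sum>z\<in>A. trans_prob Pr X h a z * (1 - w z)) \<le> 1 - w a - h * w a + h * \<epsilon>"
    proof eventually_elim
      case (elim h)
      have "(\<Sum>z\<in>A. (trans_prob Pr X h a z - (if a = z then 1 else 0)) / h * (1 - w z)) =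
          ((\<Sum>z\<in>A. trans_prob Pr X h a z * (1 - w z)) - (\<Sum>z\<in>A. (if a = z then 1 else 0) * (1 - w z))) / h"
        by (simp add: sum_subtractf[symmetric] sum_divide_distrib algebra_simps)
      also have "(\<Sum>z\<in>A. (if a = z then 1 else 0) * (1 - w z)) = 1 - w a"
        using a A by (simp add: if_distrib[of "\<lambda>c. c * _"] cong: if_cong)
      finally have "((\<Sum>z\<in>A. trans_prob Pr X h a z * (1 - w z)) - (1 - w a)) / h < - w a + \<epsilon>"
        using elim(1) by simp
      then have "(\<Sum>z\<in>A. trans_prob Pr X h a z * (1 - w z)) - (1 - w a) < (- w a + \<epsilon>) * h"
        using elim(2) by (simp only: pos_divide_less_eq)
      then show ?case by (simp only: distrib_right) (simp add: mult.commute)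
    qed
  qed
  moreover have "filterlim (\<lambda>n. t / real n) (at_right 0) sequentially"
  proof (rule tendsto_imp_filterlim_at_right)
    show "(\<lambda>n. t / real n) \<longlonglongrightarrow> 0" by (rule lim_const_over_n)
    show "\<forall>\<^sub>F n in sequentially. 0 < t / real n"
      using t by (intro eventually_sequentiallyI[of 1]) auto
  qed
  ultimately have "\<forall>\<^sub>F n in sequentially. \<forall>a\<in>A. (\<Sum>z\<in>A. trans_prob Pr X (t / real n) a z * (1 - w z)) \<le>
      1 - w a - t / real n * w a + t / real n * \<epsilon>"
    by (auto simp: filterlim_iff)
  then have "\<forall>\<^sub>F n in sequentially. 1 \<le> n \<and> (\<forall>a\<in>A. (\<Sum>z\<in>A. trans_prob Pr X (t / real n) a z * (1 - w z)) \<le>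
      1 - w a - t / real n * w a + t / real n * \<epsilon>)"
    using eventually_ge_at_top by (rule eventually_conj[rotated])
  then obtain n :: nat where n: "1 \<le> n" and step: "\<And>a. a \<in> A \<Longrightarrow>
      (\<Sum>z\<in>A. trans_prob Pr X (t / real n) a z * (1 - w z)) \<le> 1 - w a - t / real n * w a + t / real n * \<epsilon>"
    by (auto dest: eventually_happens)
  have "w x \<le> 1 / (1 + t / real n) ^ n + real n * (t / real n) * \<epsilon> +
      (1 - measure (Pr x) {\<omega> \<in> space (Pr x). \<forall>i\<le>n. X (real i * (t / real n)) \<omega> \<in> A})"
    by (rule taboo_chain_bound[OF mc x A _ _ _ step]) (use t \<epsilon> w A in auto)
  also have "1 / (1 + t / real n) ^ n \<le> 1 / (1 + t)"
  proof (intro divide_left_mono mult_pos_pos)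
    have "0 \<le> t / real n" using t by simp
    then have "1 + real n * (t / real n) \<le> (1 + t / real n) ^ n"
      by (intro Bernoulli_inequality) linarith
    then show "1 + t \<le> (1 + t / real n) ^ n" using n by simp
    with t show "0 < (1 + t / real n) ^ n" by linarith
  qed (use t in auto)
  also have "real n * (t / real n) * \<epsilon> = \<eta>" using n t by (simp add: \<epsilon>_def)
  also have "1 - measure (Pr x) {\<omega> \<in> space (Pr x). \<forall>i\<le>n. X (real i * (t / real n)) \<omega> \<in> A} \<le>
      1 - measure (Pr x) {\<omega> \<in> space (Pr x). \<forall>s\<in>\<rat> \<inter> {0..t}. X s \<omega> \<in> A}"
  proof (intro diff_left_mono finite_measure_mono)
    show "{\<omega> \<in> space (Pr x). \<forall>s\<in>\<rat> \<inter> {0..t}. X s \<omega> \<in> A} \<subseteq>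
        {\<omega> \<in> space (Pr x). \<forall>i\<le>n. X (real i * (t / real n)) \<omega> \<in> A}"
    proof safe
      fix \<omega> i assume *: "\<forall>s\<in>\<rat> \<inter> {0..t}. X s \<omega> \<in> A" and i: "i \<le> n"
      have "real i * (t / real n) \<le> real n * (t / real n)" using i t by (intro mult_right_mono) auto
      then have "real i * (t / real n) \<in> \<rat> \<inter> {0..t}" using t n by auto
      with * show "X (real i * (t / real n)) \<omega> \<in> A" by blast
    qed
    have "0 \<le> real i * (t / real n)" for i using t by simp
    then have "{\<omega> \<in> space (Pr x). \<forall>i\<in>{..n}. X (real i * (t / real n)) \<omega> \<in> A} \<in> sets (Pr x)"
      by (intro sets.sets_Collect_countable_All' predX[unfolded pred_def]) auto
    then show "{\<omega> \<in> space (Pr x). \<forall>i\<le>n. X (real i * (t / real n)) \<omega> \<in> A} \<in> sets (Pr x)"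
      by (simp only: Ball_def atMost_iff)
  qed
  finally show ?thesis by simp
qed

lemma finite_subset_incseq:
  fixes A :: "nat \<Rightarrow> 'a set"
  assumes "incseq A" "finite Y" "Y \<subseteq> (\<Union>k. A k)"
  obtains k where "Y \<subseteq> A k"
proof -
  have "\<exists>k. Y \<subseteq> A k"
    using assms(2,3)
  proof (induction Y rule: finite_induct)
    case (insert y Y)
    then obtain k l where "Y \<subseteq> A k" "y \<in> A l" by auto
    then have "insert y Y \<subseteq> A (max k l)"
      using incseqD[OF assms(1), of k "max k l"] incseqD[OF assms(1), of l "max k l"] by auto
    then show ?case by blast
  qed simp
  then show ?thesis using that by blast
qed

text \<open>As \<open>A\<close> exhausts \<open>F\<close>, the probability of leaving \<open>A\<close> before \<open>t\<close> tends to \<open>0\<close>,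
  because the path visits only finitely many states up to \<open>t\<close>. Then let \<open>t\<close> tend to infinity.\<close>

lemma regular_jump_no_bounded_growth:
  assumes F: "countable F" and mc: "markov_chain F Pr X" and paths: "regular_jump_paths F Pr X"
    and q: "conservative_q_matrix F q" and gen: "has_generator F Pr X q"
    and w: "\<And>a. a \<in> F \<Longrightarrow> 0 \<le> w a \<and> w a \<le> 1 \<and> w a \<le> gen_apply F q w a" and x: "x \<in> F"
  shows "w x = 0"
proof -
  obtain A where A: "\<And>k. finite (A k)" "incseq A" "(\<Union>k. A k) = F"
    using countable_finite_exhaustion[OF F] by blast
  interpret prob_space "Pr x" using mc x unfolding markov_chain_def by blast
  have X: "X u \<in> measurable (Pr x) (count_space F)" if "0 \<le> u" for u
    using mc x that unfolding markov_chain_def by blast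
  have predX: "Measurable.pred (Pr x) (\<lambda>\<omega>. X u \<omega> \<in> B)" if "0 \<le> u" for u B
    by (rule measurable_compose[OF X[OF that]]) auto
  have bound: "w x \<le> 1 / (1 + real m) + \<eta>" if m: "0 < m" and \<eta>: "0 < \<eta>" for m :: nat and \<eta>
  proof -
    define t where "t = real m"
    have t: "0 < t" "t \<in> \<rat>" using m by (auto simp: t_def)
    define R where "R k = {\<omega> \<in> space (Pr x). \<forall>s\<in>\<rat> \<inter> {0..t}. X s \<omega> \<in> A k}" for k
    have Rset: "R k \<in> sets (Pr x)" for k
    proof -
      have "Measurable.pred (Pr x) (\<lambda>\<omega>. \<forall>s\<in>\<rat> \<inter> {0..t}. X s \<omega> \<in> A k)"
        unfolding pred_def
        by (rule sets.sets_Collect_countable_All')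
          (auto intro!: predX[unfolded pred_def] countable_subset[OF _ countable_rat])
      then show ?thesis by (simp add: pred_def R_def)
    qed
    have "incseq R" using A(2) by (auto simp: R_def incseq_def)
    then have lim: "(\<lambda>k. measure (Pr x) (R k)) \<longlonglongrightarrow> measure (Pr x) (\<Union>k. R k)"
      using Rset by (intro finite_Lim_measure_incseq) auto
    have "AE \<omega> in Pr x. \<forall>c>0. finite {r \<in> {0<..c}. \<not> (\<forall>\<^sub>F s in at r. X s \<omega> = X r \<omega>)}"
      using paths x unfolding regular_jump_paths_def AE_conj_iff by blast
    then have "AE \<omega> in Pr x. \<omega> \<in> (\<Union>k. R k)"
    proof (rule AE_mp, intro AE_I2 impI)
      fix \<omega> assume \<omega>: "\<omega> \<in> space (Pr x)"
        and "\<forall>c>0. finite {r \<in> {0<..c}. \<not> (\<forall>\<^sub>F s in at r. X s \<omega> = X r \<omega>)}"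
      with t have fin: "finite {r \<in> {0<..t}. \<not> (\<forall>\<^sub>F s in at r. X s \<omega> = X r \<omega>)}" by blast
      have "finite ((\<lambda>s. X s \<omega>) ` {0..t})" by (rule finite_range_step_path[OF t(1) fin])
      moreover have "(\<lambda>s. X s \<omega>) ` {0..t} \<subseteq> (\<Union>k. A k)"
        using measurable_space[OF X \<omega>] A(3) by auto
      ultimately obtain k where "(\<lambda>s. X s \<omega>) ` {0..t} \<subseteq> A k"
        by (rule finite_subset_incseq[OF A(2)])
      then show "\<omega> \<in> (\<Union>k. R k)" using \<omega> by (auto simp: R_def)
    qed
    then have "measure (Pr x) (\<Union>k. R k) = 1"
      by (subst prob_eq_1) (use Rset in auto)
    with lim have "(\<lambda>k. 1 / (1 + t) + \<eta> + (1 - measure (Pr x) (R k))) \<longlonglongrightarrow> 1 / (1 + t) + \<eta> + (1 - 1)"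
      by (intro tendsto_intros) auto
    moreover obtain k0 where k0: "x \<in> A k0" using A(3) x by blast
    have "w x \<le> 1 / (1 + t) + \<eta> + (1 - measure (Pr x) (R k))" if "k0 \<le> k" for k
      unfolding R_def
      by (rule taboo_bound[OF mc q gen _ A(1) _ t \<eta> w])
        (use A(2,3) k0 that in \<open>auto dest: incseqD\<close>)
    ultimately show ?thesis unfolding t_def by (intro LIMSEQ_le_const[where a = "w x"]) auto
  qed
  have "w x \<le> 1 / (1 + real m)" if "0 < m" for m :: nat
    by (rule field_le_epsilon) (rule bound[OF that])
  moreover have "(\<lambda>m. 1 / (1 + real m)) \<longlonglongrightarrow> 0" by real_asymp
  ultimately have "w x \<le> 0"
    by (intro LIMSEQ_le_const[where a = "w x"]) (auto intro!: exI[of _ 1])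
  then show ?thesis using w[OF x] by linarith
qed

lemma ergodic_exit_barrier:
  assumes "countable F" "ergodic_regular_jump_chain F Pr X q"
  shows "\<exists>e. exit_barrier F q e"
proof (rule exit_barrier_if_no_bounded_growth[OF assms(1)])
  show "conservative_q_matrix F q" using assms(2) by (simp add: ergodic_regular_jump_chain_def)
  show "w x = 0" if "\<And>x. x \<in> F \<Longrightarrow> 0 \<le> w x \<and> w x \<le> 1 \<and> w x \<le> gen_apply F q w x" "x \<in> F" for w x
    by (rule regular_jump_no_bounded_growth[of F Pr X q])
      (use assms that in \<open>auto simp: ergodic_regular_jump_chain_def\<close>)
qed

section \<open>The truncated generator as a collapsed generator\<close>

text \<open>The target of a jump from level \<open>k\<close> in the truncated chain when the original
  chain jumps to \<open>(l, j)\<close>.\<close>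

definition collapse :: "nat \<Rightarrow> nat \<Rightarrow> state \<Rightarrow> state"
  where "collapse n k = (\<lambda>(l, j). if l \<le> n \<or> l = k then (l, j) else (n, j))"

lemma phases_eq:
  assumes "\<forall>k\<ge>1. S k = S (1::nat)" "1 \<le> n" "n \<le> m"
  shows "S m = (S n :: nat)"
  using assms(1)[rule_format, of m] assms(1)[rule_format, of n] assms(2,3) by simp

lemma collapse_in_states:
  assumes "\<forall>k\<ge>1. S k = S 1" "1 \<le> n" "y \<in> states S"
  shows "collapse n k y \<in> states S"
proof (cases y)
  case (Pair l j)
  have "S l = S n" if "\<not> l \<le> n"
    using phases_eq[OF assms(1,2), of l] that by simp
  then show ?thesis using assms(3) Pair by (auto simp: collapse_def states_def)
qed

lemma collapse_self [simp]: "collapse n (fst x) x = x"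
  by (cases x) (simp add: collapse_def)

text \<open>A row of the truncated generator is the image of the same row of \<open>q\<close> under the map
  \<open>collapse\<close>, so the truncated generator acts on \<open>u\<close> as \<open>q\<close> acts on \<open>u \<circ> collapse n k\<close> at level \<open>k\<close>.\<close>

lemma lc_truncation_fibre:
  assumes S: "\<forall>k\<ge>1. S k = S 1" and n: "1 \<le> n" and z: "z \<in> states S"
    and q: "conservative_q_matrix (states S) q" and x: "x \<in> states S"
  shows "((\<lambda>y. q x y) has_sum lc_truncation n q x z) {y \<in> states S. collapse n (fst x) y = z}"
proof -
  obtain k i where x': "x = (k, i)" by (cases x)
  obtain l j where z': "z = (l, j)" by (cases z)
  have jl: "j \<le> S l" using z z' by (simp add: states_def)
  consider "l < n" | "l = n" | "n < l" "l = k" | "n < l" "l \<noteq> k" by linarith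
  then show ?thesis
  proof cases
    case 1
    have "{y \<in> states S. collapse n (fst x) y = z} = {z}"
      using 1 z z' x' by (auto simp: collapse_def split: if_splits prod.splits)
    then show ?thesis using 1 by (auto simp: lc_truncation_def x' z' intro!: has_sum_finiteI)
  next
    case 2
    let ?M = "{m. n < m \<and> m \<noteq> k}"
    have Sm: "S m = S n" if "n < m" for m using phases_eq[OF S n, of m] that by simp
    have fib: "{y \<in> states S. collapse n (fst x) y = z} = insert (n, j) ((\<lambda>m. (m, j)) ` ?M)"
    proof (intro equalityI subsetI)
      fix y assume y: "y \<in> {y \<in> states S. collapse n (fst x) y = z}"
      obtain m j' where y': "y = (m, j')" by (cases y)
      have "(if m \<le> n \<or> m = k then (m, j') else (n, j')) = (n, j)"
        using y 2 by (simp add: collapse_def x' z' y')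
      then show "y \<in> insert (n, j) ((\<lambda>m. (m, j)) ` ?M)"
        unfolding y' by (cases "m \<le> n \<or> m = k") auto
    next
      fix y assume "y \<in> insert (n, j) ((\<lambda>m. (m, j)) ` ?M)"
      then consider "y = (n, j)" | m where "y = (m, j)" "n < m" "m \<noteq> k" by blast
      then show "y \<in> {y \<in> states S. collapse n (fst x) y = z}"
        by cases (use 2 jl Sm in \<open>auto simp: collapse_def states_def x' z'\<close>)
    qed
    have sub: "(\<lambda>m. (m, j)) ` ?M \<subseteq> states S" using fib by blast
    have inj: "inj_on (\<lambda>m. (m, j)) ?M" by (auto simp: inj_on_def)
    have "q x summable_on (\<lambda>m. (m, j)) ` ?M"
      by (rule summable_on_subset_banach[OF row_summable[OF q x] sub])
    then have "(q x has_sum infsum (q x) ((\<lambda>m. (m, j)) ` ?M)) ((\<lambda>m. (m, j)) ` ?M)"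
      by (rule has_sum_infsum)
    moreover have "infsum (q x) ((\<lambda>m. (m, j)) ` ?M) = (\<Sum>\<^sub>\<infinity>m\<in>?M. q x (m, j))"
      by (simp add: infsum_reindex[OF inj] o_def)
    ultimately have "(q x has_sum (q x (n, j) + (\<Sum>\<^sub>\<infinity>m\<in>?M. q x (m, j)))) (insert (n, j) ((\<lambda>m. (m, j)) ` ?M))"
      by (intro has_sum_insert) auto
    then show ?thesis unfolding fib using 2 by (simp add: lc_truncation_def x' z')
  next
    case 3
    have "{y \<in> states S. collapse n (fst x) y = z} = {z}"
      using 3 z z' x' by (auto simp: collapse_def split: if_splits prod.splits)
    then show ?thesis using 3 by (auto simp: lc_truncation_def x' z' intro!: has_sum_finiteI)
  next
    case 4
    have fib: "{y \<in> states S. collapse n (fst x) y = z} = {}"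
      using 4 z' x' by (auto simp: collapse_def split: if_splits prod.splits)
    show ?thesis unfolding fib using 4 by (simp add: lc_truncation_def x' z')
  qed
qed

lemma lc_truncation_has_sum:
  assumes S: "\<forall>k\<ge>1. S k = S 1" and n: "1 \<le> n"
    and q: "conservative_q_matrix (states S) q" and x: "x \<in> states S"
    and s: "((\<lambda>y. q x y * u (collapse n (fst x) y)) has_sum s) (states S)"
  shows "((\<lambda>z. lc_truncation n q x z * u z) has_sum s) (states S)"
proof -
  let ?T = "collapse n (fst x)"
  let ?B = "\<lambda>z. {y \<in> states S. ?T y = z}"
  have "bij_betw snd (Sigma (states S) ?B) (states S)"
    by (rule bij_betwI[where g = "\<lambda>y. (?T y, y)"]) (auto intro: collapse_in_states[OF S n])
  from has_sum_reindex_bij_betw[OF this, of "\<lambda>y. q x y * u (?T y)" s] s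
  have "((\<lambda>p. q x (snd p) * u (?T (snd p))) has_sum s) (Sigma (states S) ?B)" by simp
  then show ?thesis
  proof (rule has_sum_SigmaD)
    fix z assume z: "z \<in> states S"
    have "((\<lambda>y. q x y * u z) has_sum (lc_truncation n q x z * u z)) (?B z)"
      by (rule has_sum_cmult_left[OF lc_truncation_fibre[OF S n z q x]])
    then show "((\<lambda>y. q x (snd (z, y)) * u (?T (snd (z, y)))) has_sum (lc_truncation n q x z * u z)) (?B z)"
      by (subst has_sum_cong[where g = "\<lambda>y. q x y * u z"]) auto
  qed
qed

lemma lc_truncation_conservative:
  assumes S: "\<forall>k\<ge>1. S k = S 1" and n: "1 \<le> n" and q: "conservative_q_matrix (states S) q"
  shows "conservative_q_matrix (states S) (lc_truncation n q)"
  unfolding conservative_q_matrix_def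
proof (intro conjI ballI impI)
  fix x z assume x: "x \<in> states S" and z: "z \<in> states S" and "x \<noteq> z"
  show "0 \<le> lc_truncation n q x z"
  proof (rule has_sum_nonneg[OF lc_truncation_fibre[OF S n z q x]])
    fix y assume y: "y \<in> {y \<in> states S. collapse n (fst x) y = z}"
    with \<open>x \<noteq> z\<close> have "x \<noteq> y" by auto
    then show "0 \<le> q x y" using q x y unfolding conservative_q_matrix_def by auto
  qed
next
  fix x assume x: "x \<in> states S"
  have "((\<lambda>z. lc_truncation n q x z * 1) has_sum 0) (states S)"
    by (rule lc_truncation_has_sum[OF S n q x, where u = "\<lambda>_. 1"])
      (use q x in \<open>auto simp: conservative_q_matrix_def\<close>)
  then show "(lc_truncation n q x has_sum 0) (states S)" by simp
qed

lemma levelwise_nondecreasing_iterate: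
  assumes "\<forall>k\<ge>1. S k = S 1" and "levelwise_nondecreasing S v" "1 \<le> n" "n \<le> m" "j \<le> S n"
  shows "v (n, j) \<le> v (m, j)"
  using assms(4)
proof (induction m rule: dec_induct)
  case (step m)
  have "S m = S n" by (rule phases_eq[OF assms(1,3) step(1)])
  then have "v (m, j) \<le> v (Suc m, j)"
    using assms(2,3,5) step(1) unfolding levelwise_nondecreasing_def by simp
  then show ?case using step.IH by linarith
qed simp

text \<open>Collapsing moves every target to a state with a smaller value of \<open>v\<close>, and leaves the
  present state in place. Hence it can only lower \<open>Q v\<close>.\<close>

lemma lc_truncation_drift:
  assumes S: "\<forall>k\<ge>1. S k = S 1" and n: "1 \<le> n" and q: "conservative_q_matrix (states S) q"
    and v: "\<And>x. x \<in> states S \<Longrightarrow> 0 \<le> v x" and mono: "levelwise_nondecreasing S v"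
    and drift: "drift_condition (states S) q v f b C"
  shows "drift_condition (states S) (lc_truncation n q) v f b C"
  unfolding drift_condition_def
proof (intro ballI)
  fix x assume x: "x \<in> states S"
  let ?T = "collapse n (fst x)"
  have vT: "v (?T y) \<le> v y" if "y \<in> states S" for y
  proof (cases y)
    case (Pair l j)
    show ?thesis
    proof (cases "l \<le> n \<or> l = fst x")
      case False
      then have "S l = S n" using phases_eq[OF S n, of l] by simp
      then have "v (n, j) \<le> v (l, j)"
        using that False Pair by (intro levelwise_nondecreasing_iterate[OF S mono n]) (auto simp: states_def)
      then show ?thesis using False by (simp add: Pair collapse_def)
    qed (simp add: Pair collapse_def)
  qed
  have sv: "(\<lambda>y. q x y * v y) summable_on states S"
    and dv: "gen_apply (states S) q v x \<le> - f x + b * indicator C x"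
    using drift x unfolding drift_condition_def by blast+
  have sT: "(\<lambda>y. q x y * v (?T y)) summable_on states S"
  proof (rule Infinite_Sum.abs_summable_summable, rule Infinite_Sum.abs_summable_on_comparison_test')
    show "(\<lambda>y. norm (q x y * v y)) summable_on states S"
      by (rule iffD1[OF summable_on_iff_abs_summable_on_real sv])
    show "norm (q x y * v (?T y)) \<le> norm (q x y * v y)" if "y \<in> states S" for y
      using vT[OF that] v[OF that] v[OF collapse_in_states[OF S n that, of "fst x"]]
      by (auto simp: abs_mult intro!: mult_left_mono)
  qed
  have hs: "((\<lambda>z. lc_truncation n q x z * v z) has_sum gen_apply (states S) q (\<lambda>y. v (?T y)) x) (states S)"
    by (rule lc_truncation_has_sum[OF S n q x has_sum_infsum[OF sT]])
  have "gen_apply (states S) q (\<lambda>y. v (?T y)) x \<le> gen_apply (states S) q v x"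
    by (rule gen_apply_mono[OF q x _ vT sT sv]) auto
  then show "(\<lambda>z. lc_truncation n q x z * v z) summable_on states S \<and>
      gen_apply (states S) (lc_truncation n q) v x \<le> - f x + b * indicator C x"
    using dv has_sum_imp_summable[OF hs] infsumI[OF hs] by simp
qed

lemma finite_states_upto: "finite (states_upto S n)"
proof -
  have "states_upto S n = Sigma {..n} (\<lambda>k. {..S k})" by (auto simp: states_upto_def)
  then show ?thesis by simp
qed

lemma lc_truncation_exit_barrier:
  assumes S: "\<forall>k\<ge>1. S k = S 1" and n: "1 \<le> n" and q: "conservative_q_matrix (states S) q"
  shows "exit_barrier (states S) (lc_truncation n q) (\<lambda>k x. indicator (- states_upto S (n + k)) x)"
proof (rule exit_barrier_finite_closed[OF lc_truncation_conservative[OF S n q]])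
  show "finite (states_upto S (n + k))" for k by (rule finite_states_upto)
  show "states_upto S (n + k) \<subseteq> states S" for k by (auto simp: states_upto_def states_def)
  show "incseq (\<lambda>k. states_upto S (n + k))" by (auto simp: incseq_def states_upto_def)
  show "(\<Union>k. states_upto S (n + k)) = states S"
  proof (intro equalityI subsetI)
    fix x assume x: "x \<in> states S"
    then have "x \<in> states_upto S (n + fst x)" by (auto simp: states_def states_upto_def)
    then show "x \<in> (\<Union>k. states_upto S (n + k))" by blast
  qed (auto simp: states_upto_def states_def)
  show "lc_truncation n q x y = 0"
    if "x \<in> states_upto S (n + k)" "y \<in> states S - states_upto S (n + k)" for k x y
  proof -
    obtain a i l j where xy: "x = (a, i)" "y = (l, j)" by (cases x, cases y)
    have "a \<le> n + k" "n + k < l" using that by (auto simp: xy states_upto_def states_def)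
    then show ?thesis by (simp add: lc_truncation_def xy)
  qed
qed

section \<open>Transferring error bounds from the reweighted distributions\<close>

lemma ratio_le_sup_ratio:
  assumes "sup_ratio F f v < \<infinity>" "\<And>x. x \<in> F \<Longrightarrow> 0 \<le> v x" "\<And>x. x \<in> F \<Longrightarrow> 1 \<le> f x" "x \<in> F"
  shows "0 < v x" and "f x / v x \<le> enn2real (sup_ratio F f v)"
proof -
  have le: "ennreal (f x) / ennreal (v x) \<le> sup_ratio F f v"
    unfolding sup_ratio_def by (rule SUP_upper) fact
  have f: "1 \<le> f x" by (rule assms) fact
  show v: "0 < v x"
  proof (rule ccontr)
    assume "\<not> 0 < v x"
    with assms(2)[OF assms(4)] have "v x = 0" by simp
    then show False using le assms(1) f by (auto simp: top_unique)
  qed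
  have "ennreal (f x / v x) \<le> sup_ratio F f v"
    using le v f by (simp add: divide_ennreal)
  also have "\<dots> = ennreal (enn2real (sup_ratio F f v))"
    using assms(1) by simp
  finally show "f x / v x \<le> enn2real (sup_ratio F f v)" by simp
qed

locale tilted_approximation =
  fixes F :: "'a set" and p p' v f :: "'a \<Rightarrow> real" and C E :: real
  assumes p: "\<And>x. x \<in> F \<Longrightarrow> 0 \<le> p x" "(p has_sum 1) F"
    and p': "\<And>x. x \<in> F \<Longrightarrow> 0 \<le> p' x" "(p' has_sum 1) F"
    and v: "\<And>x. x \<in> F \<Longrightarrow> 0 < v x" and f: "\<And>x. x \<in> F \<Longrightarrow> 1 \<le> f x"
    and ratio: "\<And>x. x \<in> F \<Longrightarrow> f x / v x \<le> C"
    and pf: "(\<lambda>x. p x * f x) summable_on F"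
    and E: "0 \<le> E"
    and tilted_error: "sup_rel_error F (reweight F (\<lambda>x. f x / v x) p) (reweight F (\<lambda>x. f x / v x) p')
      (\<lambda>x. min 1 (v x / f x)) v \<le> ennreal E"
begin

definition mass :: "('a \<Rightarrow> real) \<Rightarrow> real"
  where "mass s = (\<Sum>\<^sub>\<infinity>x\<in>F. s x * (f x / v x))"

text \<open>With this factor, \<open>p x - r * p' x\<close> is the difference of the two reweighted distributions
  at \<open>x\<close>, multiplied by \<open>mass p * v x / f x\<close>.\<close>

definition r :: real
  where "r = mass p / mass p'"

lemma mass_bounds:
  assumes s: "\<And>x. x \<in> F \<Longrightarrow> 0 \<le> s x" "(s has_sum 1) F"
  shows "(\<lambda>x. s x * (f x / v x)) summable_on F" "0 < mass s" "mass s \<le> C"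
proof -
  have w: "0 < f x / v x" if "x \<in> F" for x
    using f[OF that] v[OF that] by simp
  have bw: "\<bar>f x / v x\<bar> \<le> C" if "x \<in> F" for x
    using w[OF that] ratio[OF that] by linarith
  show sm: "(\<lambda>x. s x * (f x / v x)) summable_on F"
    by (rule summable_on_mult_bounded[OF has_sum_imp_summable[OF s(2)] bw])
  have nn: "0 \<le> s x * (f x / v x)" if "x \<in> F" for x
    by (rule mult_nonneg_nonneg[OF s(1)[OF that] less_imp_le[OF w[OF that]]])
  show "0 < mass s"
  proof (rule ccontr)
    assume "\<not> 0 < mass s"
    then have le: "(\<Sum>\<^sub>\<infinity>x\<in>F. s x * (f x / v x)) \<le> 0" by (simp add: mass_def)
    have "s x = 0" if "x \<in> F" for x
      using nonneg_infsum_le_0D[OF le sm nn that] w[OF that] by auto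
    then have "(s has_sum 0) F" by (subst has_sum_cong[where g = "\<lambda>_. 0"]) auto
    from has_sum_unique[OF this s(2)] show False by simp
  qed
  have "mass s \<le> (\<Sum>\<^sub>\<infinity>x\<in>F. s x * C)"
    unfolding mass_def
    by (rule infsum_mono[OF sm summable_on_cmult_left[OF has_sum_imp_summable[OF s(2)]]])
      (rule mult_left_mono[OF ratio s(1)])
  also have "\<dots> = C" using infsumI[OF has_sum_cmult_left[OF s(2), of C]] by simp
  finally show "mass s \<le> C" .
qed

lemma mass_p: "0 < mass p" and mass_p': "0 < mass p'" and mass_p'_le: "mass p' \<le> C"
  using mass_bounds[of p] mass_bounds[of p'] p p' by blast+

lemma r_pos: "0 < r"
  using mass_p mass_p' by (simp add: r_def)

lemma p_summable:
  assumes "\<And>x. x \<in> F \<Longrightarrow> 1 \<le> g x \<and> g x \<le> f x"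
  shows "(\<lambda>x. p x * g x) summable_on F" and "1 \<le> (\<Sum>\<^sub>\<infinity>x\<in>F. p x * g x)"
proof -
  show sg: "(\<lambda>x. p x * g x) summable_on F"
  proof (rule summable_on_comparison_test[OF pf])
    fix x assume x: "x \<in> F"
    show "p x * g x \<le> p x * f x" using assms[OF x] p(1)[OF x] by (intro mult_left_mono) auto
    show "0 \<le> p x * g x" using assms[OF x] p(1)[OF x] by (intro mult_nonneg_nonneg) auto
  qed
  show "1 \<le> (\<Sum>\<^sub>\<infinity>x\<in>F. p x * g x)"
  proof (rule has_sum_mono[OF p(2) has_sum_infsum[OF sg]])
    fix x assume x: "x \<in> F"
    show "p x \<le> p x * g x" using mult_left_mono[of 1 "g x" "p x"] assms[OF x] p(1)[OF x] by simp
  qed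
qed

text \<open>This is the hypothesis on the reweighted distributions for the test vector
  \<open>(v / f) g\<close>, in which the weight \<open>f / v\<close> cancels.\<close>

lemma scaled_error:
  assumes g: "\<And>x. x \<in> F \<Longrightarrow> 1 \<le> g x \<and> g x \<le> f x"
  shows "(\<lambda>x. \<bar>p x - r * p' x\<bar> * g x) summable_on F"
    and "(\<Sum>\<^sub>\<infinity>x\<in>F. \<bar>p x - r * p' x\<bar> * g x) \<le> E * (\<Sum>\<^sub>\<infinity>x\<in>F. p x * g x)"
proof -
  let ?w = "\<lambda>x. f x / v x"
  let ?h = "\<lambda>x. v x / f x * g x"
  let ?P = "reweight F ?w p" and ?P' = "reweight F ?w p'"
  let ?G = "\<Sum>\<^sub>\<infinity>x\<in>F. p x * g x"
  have wh: "?w x * ?h x = g x" if "x \<in> F" for x using f[OF that] v[OF that] by simp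
  have rw: "reweight F ?w s x = s x * ?w x / mass s" for s x
    by (simp only: reweight_def mass_def)
  have assoc: "a * w / m * h = a * (w * h) / m" for a w m h :: real by simp
  have P: "?P x * ?h x = p x * g x / mass p" if "x \<in> F" for x
    by (simp only: rw assoc wh[OF that])
  have D: "\<bar>?P x - ?P' x\<bar> * ?h x = \<bar>p x - r * p' x\<bar> * g x / mass p" if "x \<in> F" for x
  proof -
    have w: "0 < ?w x" using f[OF that] v[OF that] by simp
    have "a * w / m - c * w / m' = (a - m / m' * c) / m * w" if "0 < m" "0 < m'" for a c w m m' :: real
      using that by (simp add: field_simps)
    then have "?P x - ?P' x = (p x - r * p' x) / mass p * ?w x"
      using mass_p mass_p' by (simp only: rw r_def)
    then have "\<bar>?P x - ?P' x\<bar> = \<bar>p x - r * p' x\<bar> / mass p * ?w x"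
      using w mass_p by (simp only: abs_mult abs_divide[of _ "mass p"] abs_of_pos)
    then have "\<bar>?P x - ?P' x\<bar> * ?h x = \<bar>p x - r * p' x\<bar> / mass p * (?w x * ?h x)"
      by (simp only: mult.assoc)
    also have "\<dots> = \<bar>p x - r * p' x\<bar> / mass p * g x" by (simp only: wh[OF that])
    finally show ?thesis by simp
  qed
  have h: "\<forall>x\<in>F. min 1 (v x / f x) \<le> ?h x \<and> ?h x \<le> v x"
  proof
    fix x assume x: "x \<in> F"
    have q: "0 < v x / f x" using f[OF x] v[OF x] by simp
    have "v x / f x * 1 \<le> ?h x" using q g[OF x] by (intro mult_left_mono) auto
    moreover have "?h x \<le> v x / f x * f x" using q g[OF x] by (intro mult_left_mono) auto
    moreover have "v x / f x * f x = v x" using f[OF x] by simp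
    ultimately show "min 1 (v x / f x) \<le> ?h x \<and> ?h x \<le> v x" by simp
  qed
  have sG: "(\<lambda>x. p x * g x) summable_on F" and G1: "1 \<le> ?G" using p_summable[OF g] by auto
  have pos: "0 < ?G / mass p" using G1 mass_p by simp
  have hsP: "((\<lambda>x. ?P x * ?h x) has_sum (?G / mass p)) F"
    by (rule iffD2[OF has_sum_cong[OF P] has_sum_divide_const[OF has_sum_infsum[OF sG]]])
  have pairP: "pairing F ?P ?h = ennreal (?G / mass p)"
    unfolding infsumI[OF hsP, symmetric]
  proof (rule pairing_eq_infsum[OF _ has_sum_imp_summable[OF hsP]])
    show "0 \<le> ?P x * ?h x" if "x \<in> F" for x
      unfolding P[OF that] using p(1)[OF that] g[OF that] mass_p
      by (intro divide_nonneg_pos mult_nonneg_nonneg) auto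
  qed
  have "pairing F (\<lambda>x. \<bar>?P x - ?P' x\<bar>) ?h / pairing F ?P ?h
      \<le> sup_rel_error F ?P ?P' (\<lambda>x. min 1 (v x / f x)) v"
    unfolding sup_rel_error_def by (rule SUP_upper) (use h in simp)
  also note tilted_error
  finally have "pairing F (\<lambda>x. \<bar>?P x - ?P' x\<bar>) ?h / ennreal (?G / mass p) \<le> ennreal E"
    by (simp only: pairP)
  then have "pairing F (\<lambda>x. \<bar>?P x - ?P' x\<bar>) ?h / ennreal (?G / mass p) * ennreal (?G / mass p)
      \<le> ennreal E * ennreal (?G / mass p)" by (rule mult_right_mono) simp
  also have "pairing F (\<lambda>x. \<bar>?P x - ?P' x\<bar>) ?h / ennreal (?G / mass p) * ennreal (?G / mass p) =
      pairing F (\<lambda>x. \<bar>?P x - ?P' x\<bar>) ?h"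
  proof -
    have "ennreal (?G / mass p) / ennreal (?G / mass p) = 1"
      using pos by (intro ennreal_divide_self) auto
    then show ?thesis by (simp only: ennreal_divide_times mult_1_right)
  qed
  also have "ennreal E * ennreal (?G / mass p) = ennreal (E * (?G / mass p))"
    by (rule ennreal_mult'[OF E, symmetric])
  finally have le: "pairing F (\<lambda>x. \<bar>?P x - ?P' x\<bar>) ?h \<le> ennreal (E * (?G / mass p))" .
  have nn: "0 \<le> \<bar>?P x - ?P' x\<bar> * ?h x" if "x \<in> F" for x
    using f[OF that] v[OF that] g[OF that] by (intro mult_nonneg_nonneg divide_nonneg_pos) auto
  have EG: "0 \<le> E * (?G / mass p)" by (rule mult_nonneg_nonneg[OF E less_imp_le[OF pos]])
  have pair: "(\<lambda>x. \<bar>?P x - ?P' x\<bar> * ?h x) summable_on F"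
    "(\<Sum>\<^sub>\<infinity>x\<in>F. \<bar>?P x - ?P' x\<bar> * ?h x) \<le> E * (?G / mass p)"
    by (rule summable_on_if_pairing_finite[OF nn le EG]; assumption)+
  have s: "(\<lambda>x. \<bar>p x - r * p' x\<bar> * g x / mass p) summable_on F"
    by (rule iffD1[OF summable_on_cong[OF D] pair(1)])
  have eq: "\<bar>p x - r * p' x\<bar> * g x / mass p * mass p = \<bar>p x - r * p' x\<bar> * g x" for x
    using mass_p by simp
  show "(\<lambda>x. \<bar>p x - r * p' x\<bar> * g x) summable_on F"
    using summable_on_cmult_left[OF s, of "mass p"] by (simp only: eq)
  have "(\<Sum>\<^sub>\<infinity>x\<in>F. \<bar>p x - r * p' x\<bar> * g x / mass p) \<le> E * (?G / mass p)"
    using pair(2) infsum_cong[of F "\<lambda>x. \<bar>?P x - ?P' x\<bar> * ?h x", OF D] by linarith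
  then have "(\<Sum>\<^sub>\<infinity>x\<in>F. \<bar>p x - r * p' x\<bar> * g x / mass p) * mass p \<le> E * (?G / mass p) * mass p"
    using mass_p by (intro mult_right_mono) auto
  then show "(\<Sum>\<^sub>\<infinity>x\<in>F. \<bar>p x - r * p' x\<bar> * g x) \<le> E * ?G"
    using mass_p infsum_cmult_left'[of "\<lambda>x. \<bar>p x - r * p' x\<bar> * g x / mass p" "mass p" F]
    by (simp only: eq) simp
qed

text \<open>Both distributions have mass one, so \<open>1 - r\<close> is the total mass of \<open>p - r p'\<close>.\<close>

lemma abs_one_minus_r: "\<bar>1 - r\<bar> \<le> E"
proof -
  have g: "1 \<le> (1::real) \<and> 1 \<le> f x" if "x \<in> F" for x using f[OF that] by simp
  note e = scaled_error[of "\<lambda>_. 1", OF g]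
  have hs: "((\<lambda>x. p x - r * p' x) has_sum (1 - r * 1)) F"
    by (intro has_sum_diff has_sum_cmult_right p p')
  have "norm (1 - r * 1) \<le> (\<Sum>\<^sub>\<infinity>x\<in>F. norm (p x - r * p' x))"
    by (rule norm_has_sum_bound[OF _ hs]) (use e(1) has_sum_infsum in \<open>auto\<close>)
  then show ?thesis using e(2) infsumI[OF p(2)] by simp
qed

text \<open>Pointwise, \<open>r p' \<le> p + |p - r p'|\<close>.\<close>

lemma p'_summable:
  assumes g: "\<And>x. x \<in> F \<Longrightarrow> 1 \<le> g x \<and> g x \<le> f x"
  shows "(\<lambda>x. p' x * g x) summable_on F"
    and "r * (\<Sum>\<^sub>\<infinity>x\<in>F. p' x * g x) \<le> (1 + E) * (\<Sum>\<^sub>\<infinity>x\<in>F. p x * g x)"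
proof -
  let ?d = "\<lambda>x. p x * g x + \<bar>p x - r * p' x\<bar> * g x"
  have sd: "?d summable_on F" by (intro summable_on_add p_summable scaled_error g)
  have le: "r * (p' x * g x) \<le> ?d x" and nn: "0 \<le> r * (p' x * g x)" if "x \<in> F" for x
  proof -
    have "r * p' x * g x \<le> (p x + \<bar>p x - r * p' x\<bar>) * g x"
      using g[OF that] by (intro mult_right_mono) auto
    then show "r * (p' x * g x) \<le> ?d x" by (simp add: algebra_simps)
    show "0 \<le> r * (p' x * g x)"
      using g[OF that] p'(1)[OF that] r_pos by (intro mult_nonneg_nonneg) auto
  qed
  have sr: "(\<lambda>x. r * (p' x * g x)) summable_on F"
    by (rule summable_on_comparison_test[OF sd le nn])
  then show "(\<lambda>x. p' x * g x) summable_on F"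
    using r_pos summable_on_cmult_right'[of r] by auto
  have "r * (\<Sum>\<^sub>\<infinity>x\<in>F. p' x * g x) = (\<Sum>\<^sub>\<infinity>x\<in>F. r * (p' x * g x))"
    by (rule infsum_cmult_right'[symmetric])
  also have "\<dots> \<le> infsum ?d F" by (rule infsum_mono[OF sr sd le])
  also have "\<dots> = (\<Sum>\<^sub>\<infinity>x\<in>F. p x * g x) + (\<Sum>\<^sub>\<infinity>x\<in>F. \<bar>p x - r * p' x\<bar> * g x)"
    by (intro infsum_add p_summable scaled_error g)
  also have "\<dots> \<le> (1 + E) * (\<Sum>\<^sub>\<infinity>x\<in>F. p x * g x)"
    using scaled_error(2)[OF g] by (simp add: algebra_simps)
  finally show "r * (\<Sum>\<^sub>\<infinity>x\<in>F. p' x * g x) \<le> (1 + E) * (\<Sum>\<^sub>\<infinity>x\<in>F. p x * g x)" .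
qed

text \<open>Pointwise, \<open>|p - p'| \<le> |p - r p'| + |1 - r| p'\<close>.\<close>

lemma pairing_error:
  assumes g: "\<And>x. x \<in> F \<Longrightarrow> 1 \<le> g x \<and> g x \<le> f x"
  shows "pairing F (\<lambda>x. \<bar>p x - p' x\<bar>) g
    \<le> ennreal (E * ((\<Sum>\<^sub>\<infinity>x\<in>F. p x * g x) + (\<Sum>\<^sub>\<infinity>x\<in>F. p' x * g x)))"
proof -
  let ?d = "\<lambda>x. \<bar>p x - r * p' x\<bar> * g x + E * (p' x * g x)"
  have sd: "?d summable_on F"
    by (intro summable_on_add scaled_error summable_on_cmult_right p'_summable g)
  have le: "\<bar>p x - p' x\<bar> * g x \<le> ?d x" and nn: "0 \<le> \<bar>p x - p' x\<bar> * g x" if x: "x \<in> F" for x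
  proof -
    have "\<bar>p x - p' x\<bar> \<le> \<bar>p x - r * p' x\<bar> + \<bar>r - 1\<bar> * p' x"
    proof -
      have "p x - p' x = (p x - r * p' x) + (r - 1) * p' x" by (simp add: algebra_simps)
      moreover have "\<bar>(r - 1) * p' x\<bar> = \<bar>r - 1\<bar> * p' x" using p'(1)[OF x] by (simp add: abs_mult)
      ultimately show ?thesis using abs_triangle_ineq[of "p x - r * p' x" "(r - 1) * p' x"] by simp
    qed
    also have "\<bar>r - 1\<bar> * p' x \<le> E * p' x"
      using abs_one_minus_r p'(1)[OF x] by (intro mult_right_mono) auto
    finally have "\<bar>p x - p' x\<bar> * g x \<le> (\<bar>p x - r * p' x\<bar> + E * p' x) * g x"
      using g[OF x] by (intro mult_right_mono) auto
    then show "\<bar>p x - p' x\<bar> * g x \<le> ?d x" by (simp add: algebra_simps)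
    show "0 \<le> \<bar>p x - p' x\<bar> * g x" using g[OF x] by (intro mult_nonneg_nonneg) auto
  qed
  have s: "(\<lambda>x. \<bar>p x - p' x\<bar> * g x) summable_on F"
    by (rule summable_on_comparison_test[OF sd le nn])
  have "(\<Sum>\<^sub>\<infinity>x\<in>F. \<bar>p x - p' x\<bar> * g x) \<le> infsum ?d F" by (rule infsum_mono[OF s sd le])
  also have "\<dots> = (\<Sum>\<^sub>\<infinity>x\<in>F. \<bar>p x - r * p' x\<bar> * g x) + E * (\<Sum>\<^sub>\<infinity>x\<in>F. p' x * g x)"
    by (subst infsum_add)
      (auto simp: infsum_cmult_right' intro!: scaled_error summable_on_cmult_right p'_summable g)
  also have "\<dots> \<le> E * (\<Sum>\<^sub>\<infinity>x\<in>F. p x * g x) + E * (\<Sum>\<^sub>\<infinity>x\<in>F. p' x * g x)"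
    using scaled_error(2)[OF g] by simp
  finally have "(\<Sum>\<^sub>\<infinity>x\<in>F. \<bar>p x - p' x\<bar> * g x) \<le>
      E * ((\<Sum>\<^sub>\<infinity>x\<in>F. p x * g x) + (\<Sum>\<^sub>\<infinity>x\<in>F. p' x * g x))"
    by (simp add: distrib_left)
  then show ?thesis
    by (subst pairing_eq_infsum[OF nn s]) (auto intro: ennreal_leI)
qed

lemma total_variation_error: "pairing F (\<lambda>x. \<bar>p x - p' x\<bar>) (\<lambda>_. 1) \<le> ennreal (2 * E)"
proof -
  have g: "1 \<le> (1::real) \<and> 1 \<le> f x" if "x \<in> F" for x using f[OF that] by simp
  show ?thesis
    using pairing_error[of "\<lambda>_. 1", OF g] by (simp add: infsumI[OF p(2)] infsumI[OF p'(2)] mult.commute)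
qed

lemma sup_rel_error_bound:
  assumes \<kappa>: "\<And>g. (\<And>x. x \<in> F \<Longrightarrow> 1 \<le> g x \<and> g x \<le> f x) \<Longrightarrow>
      (\<Sum>\<^sub>\<infinity>x\<in>F. p' x * g x) \<le> \<kappa> * (\<Sum>\<^sub>\<infinity>x\<in>F. p x * g x)"
  shows "sup_rel_error F p p' (\<lambda>_. 1) f \<le> ennreal (E * (1 + \<kappa>))"
  unfolding sup_rel_error_def
proof (rule SUP_least)
  fix g assume "g \<in> {g. \<forall>x\<in>F. 1 \<le> g x \<and> g x \<le> f x}"
  then have g: "1 \<le> g x \<and> g x \<le> f x" if "x \<in> F" for x using that by blast
  let ?G = "\<Sum>\<^sub>\<infinity>x\<in>F. p x * g x"
  have sG: "(\<lambda>x. p x * g x) summable_on F" and G1: "1 \<le> ?G" using p_summable[OF g] by auto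
  have pairG: "pairing F p g = ennreal ?G"
    by (rule pairing_eq_infsum[OF mult_nonneg_nonneg sG]) (use p(1) g in force)+
  have "pairing F (\<lambda>x. \<bar>p x - p' x\<bar>) g \<le> ennreal (E * (?G + (\<Sum>\<^sub>\<infinity>x\<in>F. p' x * g x)))"
    by (rule pairing_error[OF g])
  also have "\<dots> \<le> ennreal (?G * (E * (1 + \<kappa>)))"
    using mult_left_mono[OF \<kappa>[OF g] E] by (intro ennreal_leI) (simp add: algebra_simps)
  also have "\<dots> = ennreal ?G * ennreal (E * (1 + \<kappa>))"
    using G1 by (intro ennreal_mult') linarith
  finally show "pairing F (\<lambda>x. \<bar>p x - p' x\<bar>) g / pairing F p g \<le> ennreal (E * (1 + \<kappa>))"
    unfolding pairG using G1 by (intro divide_le_posI_ennreal) auto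
qed

end

section \<open>Error bounds for the truncated stationary distribution\<close>

theorem theorem3p1:
  fixes S :: "nat \<Rightarrow> nat"
    and Pr :: "state \<Rightarrow> 'w measure" and X :: "real \<Rightarrow> 'w \<Rightarrow> state"
    and q :: "state \<Rightarrow> state \<Rightarrow> real"
    and \<pi> :: "state \<Rightarrow> real" and \<pi>n :: "nat \<Rightarrow> state \<Rightarrow> real"
    and v f :: "state \<Rightarrow> real" and b :: real and K :: nat
    and E :: "real \<Rightarrow> real"
    and F :: "state set" and C bh :: real
    and \<pi>h :: "state \<Rightarrow> real" and \<pi>nh :: "nat \<Rightarrow> state \<Rightarrow> real"
  assumes "\<forall>k\<ge>1. S k = S 1"
    and "F = states S"
    and "ergodic_regular_jump_chain F Pr X q"
    and "stationary_distribution F q \<pi>"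
    and "\<forall>n\<ge>1. \<exists>!A. A \<subseteq> states_upto S n \<and>
           communicating_class F (lc_truncation n q) A \<and> closed_class F (lc_truncation n q) A"
    and "\<forall>n\<ge>1. stationary_distribution F (lc_truncation n q) (\<pi>n n)"
    and "b > 0"
    and "\<forall>x\<in>F. 0 \<le> v x"
    and "\<forall>x\<in>F. 1 \<le> f x"
    and "drift_condition F q v f b (states_upto S K)"
    and "sup_ratio F f v < \<infinity>"
    and "C = enn2real (sup_ratio F f v)"
    and "\<pi>h = reweight F (\<lambda>x. f x / v x) \<pi>"
    and "\<forall>n\<ge>1. \<pi>nh n = reweight F (\<lambda>x. f x / v x) (\<pi>n n)"
    and "bh = b * Max ((\<lambda>x. v x / f x) ` states_upto S K)"
    and "\<forall>t\<ge>0. 0 \<le> E t"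
    and "\<forall>n\<ge>1. sup_rel_error F \<pi>h (\<pi>nh n) (\<lambda>x. min 1 (v x / f x)) v \<le> ennreal (E (real n))"
  shows "(\<forall>n\<ge>1. pairing F (\<lambda>x. \<bar>\<pi> x - \<pi>n n x\<bar>) (\<lambda>x. 1) \<le> ennreal (2 * E (real n))) \<and>
    (\<forall>n\<ge>1. sup_rel_error F \<pi> (\<pi>n n) (\<lambda>x. 1) f \<le>
       ennreal (E (real n) * (1 + (1 + E (real n)) /
         max (1 - min (E (real n)) 1) (inverse (bh * C))))) \<and>
    (levelwise_nondecreasing S v \<longrightarrow>
     (\<forall>n\<ge>1. sup_rel_error F \<pi> (\<pi>n n) (\<lambda>x. 1) f \<le>
       ennreal (E (real n) * (1 + min ((1 + E (real n)) /
         max (1 - min (E (real n)) 1) (inverse (bh * C))) b))))"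
proof -
  note S = assms(1) and F = assms(2)
  let ?K = "states_upto S K"
  have q: "conservative_q_matrix F q"
    using assms(3) by (simp add: ergodic_regular_jump_chain_def)
  have f: "1 \<le> f x" and v0: "0 \<le> v x" if "x \<in> F" for x using assms(8,9) that by auto
  have f0: "0 \<le> f x" if "x \<in> F" for x using f[OF that] by simp
  have v: "0 < v x" and ratio: "f x / v x \<le> C" if "x \<in> F" for x
    using ratio_le_sup_ratio[OF assms(11) v0 f that] assms(12) by auto
  have KF: "?K \<subseteq> F" by (auto simp: F states_def states_upto_def)
  have \<pi>: "0 \<le> \<pi> x" if "x \<in> F" for x using assms(4) that by (auto simp: stationary_distribution_def)
  have \<pi>1: "(\<pi> has_sum 1) F" using assms(4) by (auto simp: stationary_distribution_def)
  have \<pi>n: "0 \<le> \<pi>n n x" if "1 \<le> n" "x \<in> F" for n x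
    using assms(6) that by (auto simp: stationary_distribution_def)
  have \<pi>n1: "(\<pi>n n has_sum 1) F" if "1 \<le> n" for n
    using assms(6) that by (auto simp: stationary_distribution_def)
  obtain e where e: "exit_barrier F q e"
    using ergodic_exit_barrier[OF _ assms(3)] by auto
  have b0: "0 \<le> b" using assms(7) by simp
  have drift: "(\<lambda>x. \<pi> x * f x) summable_on F"
    "(\<Sum>\<^sub>\<infinity>x\<in>F. \<pi> x * f x) \<le> b * (\<Sum>\<^sub>\<infinity>x\<in>F. \<pi> x * indicator ?K x)"
    by (rule stationary_drift_bound[OF q assms(4) e v0 f0 b0 assms(10)]; assumption)+
  have \<pi>K: "1 \<le> b * (\<Sum>\<^sub>\<infinity>x\<in>F. \<pi> x * indicator ?K x)"
  proof -
    have "1 \<le> (\<Sum>\<^sub>\<infinity>x\<in>F. \<pi> x * f x)"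
    proof (rule has_sum_mono[OF \<pi>1 has_sum_infsum[OF drift(1)]])
      show "\<pi> x \<le> \<pi> x * f x" if "x \<in> F" for x
        using mult_left_mono[OF f[OF that] \<pi>[OF that]] by simp
    qed
    then show ?thesis using drift(2) by linarith
  qed
  define m where "m = Max ((\<lambda>x. v x / f x) ` ?K)"
  have m_ge: "v x / f x \<le> m" if "x \<in> ?K" for x
    unfolding m_def by (rule Max_ge) (use finite_states_upto that in auto)
  have "(0, 0) \<in> ?K" by (simp add: states_upto_def)
  then have C0: "0 < C" and m0: "0 < m"
  proof -
    assume K: "(0, 0) \<in> ?K"
    with KF have "(0, 0) \<in> F" by blast
    then have "0 < f (0, 0) / v (0, 0)" "0 < v (0, 0) / f (0, 0)"
      using v[of "(0, 0)"] f[of "(0, 0)"] by simp_all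
    then show "0 < C" "0 < m" using ratio[OF \<open>(0, 0) \<in> F\<close>] m_ge[OF K] by linarith+
  qed
  have bh: "bh = b * m" by (simp add: assms(15) m_def)
  have bh0: "0 < bh" using assms(7) m0 by (simp add: bh)
  have tilt: "tilted_approximation F \<pi> (\<pi>n n) v f C (E (real n))" if n: "1 \<le> n" for n
  proof
    show "sup_rel_error F (reweight F (\<lambda>x. f x / v x) \<pi>) (reweight F (\<lambda>x. f x / v x) (\<pi>n n))
        (\<lambda>x. min 1 (v x / f x)) v \<le> ennreal (E (real n))"
      using assms(17)[rule_format, OF n] assms(14)[rule_format, OF n] assms(13) by simp
    show "0 \<le> E (real n)" using assms(16) by simp
  qed (fact \<pi> \<pi>1 \<pi>n[OF n] \<pi>n1[OF n] v f ratio drift(1))+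
  have r_ge: "max (1 - min (E (real n)) 1) (inverse (bh * C)) \<le> tilted_approximation.r F \<pi> (\<pi>n n) v f"
    (is "max ?a ?c \<le> ?r") if n: "1 \<le> n" for n
  proof -
    interpret t: tilted_approximation F \<pi> "\<pi>n n" v f C "E (real n)" by (rule tilt[OF n])
    have "?a \<le> ?r" using t.abs_one_minus_r t.r_pos by linarith
    moreover have "?c \<le> ?r"
      \<comment> \<open>On \<open>F\<^sub>K\<close> the weight \<open>f / v\<close> is at least \<open>1 / m\<close>, and \<open>\<pi>\<close> gives \<open>F\<^sub>K\<close> at least \<open>1 / b\<close>.\<close>
    proof -
      have "(\<Sum>\<^sub>\<infinity>x\<in>F. \<pi> x * indicator ?K x) \<le> (\<Sum>\<^sub>\<infinity>x\<in>F. \<pi> x * (f x / v x) * m)"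
      proof (rule infsum_mono)
        show "(\<lambda>x. \<pi> x * indicator ?K x) summable_on F"
          by (rule summable_on_mult_bounded[OF has_sum_imp_summable[OF \<pi>1], of _ 1])
            (auto simp: indicator_def)
        show "(\<lambda>x. \<pi> x * (f x / v x) * m) summable_on F"
          by (intro summable_on_cmult_left t.mass_bounds(1)[OF \<pi> \<pi>1])
        fix x assume x: "x \<in> F"
        have w: "0 < f x / v x" using v[OF x] f[OF x] by simp
        have "indicator ?K x \<le> f x / v x * m"
        proof (cases "x \<in> ?K")
          case True
          have "1 = f x / v x * (v x / f x)" using v[OF x] f[OF x] by simp
          also have "\<dots> \<le> f x / v x * m" using w m_ge[OF True] by (intro mult_left_mono) auto
          finally show ?thesis using True by simp
        next
          case False
          then show ?thesis using mult_pos_pos[OF w m0] by simp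
        qed
        from mult_left_mono[OF this \<pi>[OF x]]
        show "\<pi> x * indicator ?K x \<le> \<pi> x * (f x / v x) * m" by (simp only: mult.assoc)
      qed
      also have "\<dots> = t.mass \<pi> * m" unfolding t.mass_def by (rule infsum_cmult_left')
      finally have "b * (\<Sum>\<^sub>\<infinity>x\<in>F. \<pi> x * indicator ?K x) \<le> b * (t.mass \<pi> * m)"
        using b0 by (intro mult_left_mono)
      with \<pi>K have "1 \<le> bh * t.mass \<pi>" by (simp add: bh mult.assoc mult.commute)
      then have "1 / bh \<le> t.mass \<pi>" using bh0 by (simp add: divide_le_eq mult.commute)
      then have "1 / bh / C \<le> t.mass \<pi> / t.mass (\<pi>n n)"
        using t.mass_p t.mass_p' t.mass_p'_le C0 bh0 by (intro frac_le) auto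
      then show ?thesis by (simp add: t.r_def inverse_eq_divide)
    qed
    ultimately show ?thesis by simp
  qed
  have max_pos: "0 < max (1 - min (E (real n)) 1) (inverse (bh * C))" for n
    using bh0 C0 by (simp add: less_max_iff_disj)
  have divide_bound: "a \<le> c / M * d" if "M * a \<le> c * d" "0 < M" for a c d M :: real
    using that by (simp add: field_simps)
  have general: "sup_rel_error F \<pi> (\<pi>n n) (\<lambda>x. 1) f \<le> ennreal (E (real n) * (1 + (1 + E (real n)) /
      max (1 - min (E (real n)) 1) (inverse (bh * C))))" if n: "1 \<le> n" for n
  proof -
    interpret t: tilted_approximation F \<pi> "\<pi>n n" v f C "E (real n)" by (rule tilt[OF n])
    let ?M = "max (1 - min (E (real n)) 1) (inverse (bh * C))"
    show ?thesis
    proof (rule t.sup_rel_error_bound)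
      fix g assume g: "\<And>x. x \<in> F \<Longrightarrow> 1 \<le> g x \<and> g x \<le> f x"
      have "0 \<le> (\<Sum>\<^sub>\<infinity>x\<in>F. \<pi>n n x * g x)"
        using g \<pi>n[OF n] by (intro infsum_nonneg mult_nonneg_nonneg) force+
      then have "?M * (\<Sum>\<^sub>\<infinity>x\<in>F. \<pi>n n x * g x) \<le> t.r * (\<Sum>\<^sub>\<infinity>x\<in>F. \<pi>n n x * g x)"
        by (intro mult_right_mono r_ge n)
      also have "\<dots> \<le> (1 + E (real n)) * (\<Sum>\<^sub>\<infinity>x\<in>F. \<pi> x * g x)" by (rule t.p'_summable(2)[OF g])
      finally show "(\<Sum>\<^sub>\<infinity>x\<in>F. \<pi>n n x * g x) \<le> (1 + E (real n)) / ?M * (\<Sum>\<^sub>\<infinity>x\<in>F. \<pi> x * g x)"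
        by (rule divide_bound) (rule max_pos)
    qed
  qed
  have monotone: "sup_rel_error F \<pi> (\<pi>n n) (\<lambda>x. 1) f \<le> ennreal (E (real n) * (1 + b))"
    if n: "1 \<le> n" and mono: "levelwise_nondecreasing S v" for n
  proof -
    interpret t: tilted_approximation F \<pi> "\<pi>n n" v f C "E (real n)" by (rule tilt[OF n])
    note qS = q[unfolded F]
    have drift_n: "drift_condition F (lc_truncation n q) v f b ?K"
      unfolding F by (rule lc_truncation_drift[OF S n qS _ mono assms(10)[unfolded F]])
        (use v0 F in blast)
    have bound_n: "(\<lambda>x. \<pi>n n x * f x) summable_on F"
      "(\<Sum>\<^sub>\<infinity>x\<in>F. \<pi>n n x * f x) \<le> b * (\<Sum>\<^sub>\<infinity>x\<in>F. \<pi>n n x * indicator ?K x)"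
      by (rule stationary_drift_bound[OF lc_truncation_conservative[OF S n qS, folded F]
        assms(6)[rule_format, OF n] lc_truncation_exit_barrier[OF S n qS, folded F] v0 f0 b0 drift_n];
        assumption)+
    have "(\<Sum>\<^sub>\<infinity>x\<in>F. \<pi>n n x * indicator ?K x) \<le> 1"
    proof (rule has_sum_mono[OF has_sum_infsum \<pi>n1[OF n]])
      show "(\<lambda>x. \<pi>n n x * indicator ?K x) summable_on F"
        by (rule summable_on_mult_bounded[OF has_sum_imp_summable[OF \<pi>n1[OF n]], of _ 1])
          (auto simp: indicator_def)
      show "\<pi>n n x * indicator ?K x \<le> \<pi>n n x" if "x \<in> F" for x
        using \<pi>n[OF n that] by (simp add: indicator_def)
    qed
    then have "b * (\<Sum>\<^sub>\<infinity>x\<in>F. \<pi>n n x * indicator ?K x) \<le> b" using b0 by (simp add: mult_left_le)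
    with bound_n(2) have \<pi>nf: "(\<Sum>\<^sub>\<infinity>x\<in>F. \<pi>n n x * f x) \<le> b" by linarith
    show ?thesis
    proof (rule t.sup_rel_error_bound)
      fix g assume g: "\<And>x. x \<in> F \<Longrightarrow> 1 \<le> g x \<and> g x \<le> f x"
      have "(\<Sum>\<^sub>\<infinity>x\<in>F. \<pi>n n x * g x) \<le> (\<Sum>\<^sub>\<infinity>x\<in>F. \<pi>n n x * f x)"
        by (rule infsum_mono[OF t.p'_summable(1)[OF g] bound_n(1)])
          (use g \<pi>n[OF n] in \<open>auto intro!: mult_left_mono\<close>)
      also note \<pi>nf
      also have "b \<le> b * (\<Sum>\<^sub>\<infinity>x\<in>F. \<pi> x * g x)"
        using mult_left_mono[OF t.p_summable(2)[OF g] b0] by simp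
      finally show "(\<Sum>\<^sub>\<infinity>x\<in>F. \<pi>n n x * g x) \<le> b * (\<Sum>\<^sub>\<infinity>x\<in>F. \<pi> x * g x)" .
    qed
  qed
  have tv: "pairing F (\<lambda>x. \<bar>\<pi> x - \<pi>n n x\<bar>) (\<lambda>x. 1) \<le> ennreal (2 * E (real n))" if n: "1 \<le> n" for n
    by (rule tilted_approximation.total_variation_error[OF tilt[OF n]])
  show ?thesis
  proof (intro conjI allI impI)
    fix n :: nat assume n: "1 \<le> n" and mono: "levelwise_nondecreasing S v"
    let ?x = "(1 + E (real n)) / max (1 - min (E (real n)) 1) (inverse (bh * C))"
    show "sup_rel_error F \<pi> (\<pi>n n) (\<lambda>x. 1) f \<le> ennreal (E (real n) * (1 + min ?x b))"
    proof (cases "?x \<le> b")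
      case True
      then show ?thesis using general[OF n] by (simp only: min_absorb1)
    next
      case False
      then have "b \<le> ?x" by linarith
      then show ?thesis using monotone[OF n mono] by (simp only: min_absorb2)
    qed
  qed (use tv general in blast)+
qed

end
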